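(* Let $k\ge1$ and let $S=\{s_1,\ldots,s_k\}$ with $s_1=0$ and $s_i=2^{i-1}$ for $i=2,\ldots,k$. Then for $\mathrm{OFAL}(S,c)$ (any capacity $c$), the algorithm PTCP $\mathcal{A}^*$ is $5$-competitive, while the competitive ratio of the greedy algorithm $\mathcal{G}$ is at least $2^k-1$.
   Context: Online facility assignment on a line $\mathrm{OFAL}(S,c)$: servers $S$ at distinct points of $\mathbb{R}$ (identified with their positions), capacity $c:S\to\mathbb{N}$ with $c(s)\ge1$. A request sequence $\sigma=r_1\cdots r_n$ of points of $\mathbb{R}$, $n\le\sum_s c(s)$, is revealed one at a time; a server is free if fewer than $c(s)$ requests are matched with it; each $r_i$ must be irrevocably matched upon arrival with a free server $s$ at cost $|r_i-s|$. $\mathcal{A}(\sigma|S)$ is the total cost of $\mathcal{A}$, $\mathrm{Opt}(\sigma|S)$ the optimal offline (capacity-respecting) cost. $\mathcal{A}$ is $\beta$-competitive if $\mathcal{A}(\sigma|S)\le\beta\,\mathrm{Opt}(\sigma|S)$ for all $\sigma$; the competitive ratio is the infimum of such $\beta\ge1$. The greedy algorithm $\mathcal{G}$ matches each request with its nearest free server. PTCP: for a server set $S=\{s_1<\cdots<s_k\}$ and nonempty set $F\subseteq S$ of free servers, $\mathcal{A}^*[S](r,F)$ is defined recursively: if $F=\{s\}$ output $s$; otherwise fix $a$ with $s_{a+1}-s_a=\max_u(s_{u+1}-s_u)$, let $S_1=\{s_1,\ldots,s_a\}$, $S_2=\{s_{a+1},\ldots,s_k\}$, $\Delta_1=s_a-s_1$,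 $\Delta_2=s_k-s_{a+1}$, $D=s_{a+1}-s_a$, $x=\frac{\Delta_2+D}{\Delta_1+\Delta_2+2D}D$; if ($r\le s_a+x$ and $F\cap S_1\ne\emptyset$) or $F\cap S_2=\emptyset$ output $\mathcal{A}^*[S_1](r,F\cap S_1)$, otherwise output $\mathcal{A}^*[S_2](r,F\cap S_2)$. $\mathcal{A}^*$ matches each arriving request $r$ with $\mathcal{A}^*[S](r,F)$ for the current free set $F$. *)

theory Defs
  imports Complex_Main "HOL-Library.Extended_Real"
begin

text \<open>A (partial) matching is the list of pairs (request, server) in order of arrival.\<close>

type_synonym matching = "(real \<times> real) list"

definition match_cost :: "matching \<Rightarrow> real" where
  "match_cost M = (\<Sum>(r, s)\<leftarrow>M. \<bar>r - s\<bar>)"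

definition load :: "matching \<Rightarrow> real \<Rightarrow> nat" where
  "load M s = count_list (map snd M) s"

definition free :: "real set \<Rightarrow> (real \<Rightarrow> nat) \<Rightarrow> matching \<Rightarrow> real set" where
  "free S c M = {s \<in> S. load M s < c s}"

definition matchings :: "real set \<Rightarrow> (real \<Rightarrow> nat) \<Rightarrow> real list \<Rightarrow> matching set" where
  "matchings S c \<sigma> =
     {M. map fst M = \<sigma> \<and> snd ` set M \<subseteq> S \<and> (\<forall>s\<in>S. load M s \<le> c s)}"

text \<open>For finite \<open>S\<close> and \<open>length \<sigma> \<le> sum c S\<close> this is a minimum over a finite nonempty set.\<close>

definition Opt :: "real set \<Rightarrow> (real \<Rightarrow> nat) \<Rightarrow> real list \<Rightarrow> real" where
  "Opt S c \<sigma> = Min (match_cost ` matchings S c \<sigma>)"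

text \<open>A deterministic online algorithm selects a server from the matching built so far
  and the current request. Servers and capacities are fixed beforehand.\<close>

type_synonym online_alg = "matching \<Rightarrow> real \<Rightarrow> real"

primrec serve :: "online_alg \<Rightarrow> matching \<Rightarrow> real list \<Rightarrow> matching" where
  "serve A M [] = M"
| "serve A M (r # \<sigma>) = serve A (M @ [(r, A M r)]) \<sigma>"

definition alg_cost :: "online_alg \<Rightarrow> real list \<Rightarrow> real" where
  "alg_cost A \<sigma> = match_cost (serve A [] \<sigma>)"

definition competitive :: "real set \<Rightarrow> (real \<Rightarrow> nat) \<Rightarrow> online_alg \<Rightarrow> real \<Rightarrow> bool" where
  "competitive S c A \<beta> \<longleftrightarrow>
     (\<forall>\<sigma>. length \<sigma> \<le> (\<Sum>s\<in>S. c s) \<longrightarrow> alg_cost A \<sigma> \<le> \<beta> * Opt S c \<sigma>)"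

text \<open>Extended reals, so that the ratio is \<open>\<infinity>\<close> if no \<open>\<beta>\<close> works.\<close>

definition competitive_ratio :: "real set \<Rightarrow> (real \<Rightarrow> nat) \<Rightarrow> online_alg \<Rightarrow> ereal" where
  "competitive_ratio S c A = (INF \<beta> \<in> {\<beta>. 1 \<le> \<beta> \<and> competitive S c A \<beta>}. ereal \<beta>)"

text \<open>Ties between equally near free servers may be broken in any way, even depending
  on the history. If no server is free, the choice is irrelevant.\<close>

definition greedy :: "real set \<Rightarrow> (real \<Rightarrow> nat) \<Rightarrow> online_alg \<Rightarrow> bool" where
  "greedy S c A \<longleftrightarrow>
     (\<forall>M r. free S c M \<noteq> {} \<longrightarrow>
        is_arg_min (\<lambda>s. \<bar>r - s\<bar>) (\<lambda>s. s \<in> free S c M) (A M r))"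

text \<open>\<open>srv S i\<close> is the \<open>i\<close>-th smallest server of \<open>S\<close>, for \<open>1 \<le> i \<le> card S\<close>.\<close>

definition srv :: "real set \<Rightarrow> nat \<Rightarrow> real" where
  "srv S i = sorted_list_of_set S ! (i - 1)"

definition max_gaps :: "real set \<Rightarrow> nat set" where
  "max_gaps S = {a. 1 \<le> a \<and> a < card S \<and>
     (\<forall>u. 1 \<le> u \<and> u < card S \<longrightarrow>
        srv S (u + 1) - srv S u \<le> srv S (a + 1) - srv S a)}"

text \<open>The largest gap need not be unique; \<open>\<tau>\<close> fixes one for every server set that occurs
  in the recursion.\<close>

definition gap_choice :: "real set \<Rightarrow> (real set \<Rightarrow> nat) \<Rightarrow> bool" where
  "gap_choice S \<tau> \<longleftrightarrow> (\<forall>T\<subseteq>S. 2 \<le> card T \<longrightarrow> \<tau> T \<in> max_gaps T)"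

lemma srv_strict_mono:
  assumes "1 \<le> i" "i < j" "j \<le> card S"
  shows "srv S i < srv S j"
  using assms sorted_wrt_nth_less[OF strict_sorted_list_of_set, of "i - 1" "j - 1" S]
  by (auto simp: srv_def)

lemma srv_mem:
  assumes "1 \<le> i" "i \<le> card S"
  shows "srv S i \<in> S"
proof -
  have "finite S" using assms by (metis card.infinite le_zero_eq not_one_le_zero)
  moreover have "srv S i \<in> set (sorted_list_of_set S)"
    unfolding srv_def using assms by (intro nth_mem) auto
  ultimately show ?thesis by simp
qed

text \<open>The \<open>undefined\<close> branch, which makes the recursion terminate for every \<open>\<tau>\<close>, is not
  reached if \<open>gap_choice S \<tau>\<close>, \<open>F \<subseteq> S\<close> and \<open>F \<noteq> {}\<close>.\<close>

function ptcp :: "(real set \<Rightarrow> nat) \<Rightarrow> real set \<Rightarrow> real \<Rightarrow> real set \<Rightarrow> real" where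
  "ptcp \<tau> S r F =
     (if is_singleton F then the_elem F
      else if \<tau> S \<notin> max_gaps S then undefined
      else
        (let a = \<tau> S;
             S1 = {s \<in> S. s \<le> srv S a};
             S2 = {s \<in> S. srv S (a + 1) \<le> s};
             \<Delta>1 = srv S a - srv S 1;
             \<Delta>2 = srv S (card S) - srv S (a + 1);
             D = srv S (a + 1) - srv S a;
             x = (\<Delta>2 + D) / (\<Delta>1 + \<Delta>2 + 2 * D) * D
         in if (r \<le> srv S a + x \<and> F \<inter> S1 \<noteq> {}) \<or> F \<inter> S2 = {}
            then ptcp \<tau> S1 r (F \<inter> S1)
            else ptcp \<tau> S2 r (F \<inter> S2)))"
  by auto

lemma split_less:
  assumes "a \<in> max_gaps S"
  shows "card {s \<in> S. s \<le> srv S a} < card S" "card {s \<in> S. srv S (a + 1) \<le> s} < card S"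
proof -
  have a: "1 \<le> a" "a < card S" using assms by (auto simp: max_gaps_def)
  then have "finite S" by (metis card.infinite not_less_zero)
  have lt: "srv S a < srv S (a + 1)" using a by (intro srv_strict_mono) auto
  have mem: "srv S a \<in> S" "srv S (a + 1) \<in> S" using a by (auto intro: srv_mem)
  have "{s \<in> S. s \<le> srv S a} \<subset> S" "{s \<in> S. srv S (a + 1) \<le> s} \<subset> S"
    using lt mem linorder_not_le by blast+
  with \<open>finite S\<close> show "card {s \<in> S. s \<le> srv S a} < card S"
    "card {s \<in> S. srv S (a + 1) \<le> s} < card S"
    by (simp_all add: psubset_card_mono)
qed

termination
  by (relation "measure (\<lambda>(\<tau>, S, r, F). card S)") (use split_less in auto)

declare ptcp.simps [simp del]

definition ptcp_alg :: "(real set \<Rightarrow> nat) \<Rightarrow> real set \<Rightarrow> (real \<Rightarrow> nat) \<Rightarrow> online_alg" where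
  "ptcp_alg \<tau> S c M r = ptcp \<tau> S r (free S c M)"

text \<open>Sanity checks: gap choices and greedy algorithms exist, and PTCP always selects
  a free server.\<close>

lemma max_gaps_nonempty:
  assumes "2 \<le> card S"
  shows "max_gaps S \<noteq> {}"
proof -
  let ?I = "{1..<card S}" and ?g = "\<lambda>u. srv S (u + 1) - srv S u"
  have "finite ?I" "?I \<noteq> {}" using assms by auto
  then obtain a where "a \<in> ?I" "\<forall>u\<in>?I. ?g u \<le> ?g a"
    using Max_in[of "?g ` ?I"] Max_ge[of "?g ` ?I"] by fastforce
  then have "a \<in> max_gaps S" by (auto simp: max_gaps_def)
  then show ?thesis by blast
qed

lemma gap_choice_exists: "\<exists>\<tau>. gap_choice S \<tau>"
  by (rule exI[of _ "\<lambda>T. SOME a. a \<in> max_gaps T"])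
     (use max_gaps_nonempty in \<open>auto simp: gap_choice_def some_in_eq\<close>)

lemma greedy_exists:
  assumes "finite S"
  shows "\<exists>A. greedy S c A"
proof -
  have "\<exists>s. is_arg_min (\<lambda>s. \<bar>r - s\<bar>) (\<lambda>s. s \<in> free S c M) s" if "free S c M \<noteq> {}" for M r
    using that assms ex_is_arg_min_if_finite[of "free S c M" "\<lambda>s. \<bar>r - s\<bar>"]
    by (auto simp: free_def)
  then show ?thesis unfolding greedy_def by metis
qed

lemma split_Un:
  assumes "a \<in> max_gaps S"
  shows "S = {s \<in> S. s \<le> srv S a} \<union> {s \<in> S. srv S (a + 1) \<le> s}"
proof -
  have a: "1 \<le> a" "a < card S" using assms by (auto simp: max_gaps_def)
  then have fin: "finite S" by (metis card.infinite not_less_zero)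
  have "s \<le> srv S a \<or> srv S (a + 1) \<le> s" if s: "s \<in> S" for s
  proof -
    obtain i where i: "i < card S" "sorted_list_of_set S ! i = s"
      using s fin by (metis in_set_conv_nth length_sorted_list_of_set set_sorted_list_of_set)
    then have "srv S (i + 1) = s" by (simp add: srv_def)
    consider "i + 1 < a" | "i + 1 = a" | "i + 1 = a + 1" | "a + 1 < i + 1" by linarith
    then show ?thesis
    proof cases
      case 1
      then show ?thesis using a srv_strict_mono[of "i + 1" a S] \<open>srv S (i + 1) = s\<close> by simp
    next
      case 4
      then show ?thesis using i srv_strict_mono[of "a + 1" "i + 1" S] \<open>srv S (i + 1) = s\<close> by simp
    qed (use \<open>srv S (i + 1) = s\<close> in auto)
  qed
  then show ?thesis by blast
qed

lemma ptcp_mem: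
  assumes "gap_choice S \<tau>" "finite S" "F \<subseteq> S" "F \<noteq> {}"
  shows "ptcp \<tau> S r F \<in> F"
  using assms
proof (induction \<tau> S r F rule: ptcp.induct)
  case (1 \<tau> S r F)
  show ?case
  proof (cases "is_singleton F")
    case True
    then show ?thesis by (subst ptcp.simps) (auto simp: is_singleton_def)
  next
    case False
    have "card F \<noteq> 1" "card F \<noteq> 0"
      using False 1 by (auto simp: is_singleton_altdef finite_subset card_eq_0_iff)
    moreover have "card F \<le> card S" using 1 by (intro card_mono)
    ultimately have "2 \<le> card S" by linarith
    then have a: "\<tau> S \<in> max_gaps S" using 1(3) by (auto simp: gap_choice_def)
    let ?S1 = "{s \<in> S. s \<le> srv S (\<tau> S)}" and ?S2 = "{s \<in> S. srv S (\<tau> S + 1) \<le> s}"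
    have gc: "gap_choice ?S1 \<tau>" "gap_choice ?S2 \<tau>"
      using 1(3) by (auto simp: gap_choice_def subset_eq)
    have "F \<inter> ?S1 \<noteq> {} \<or> F \<inter> ?S2 \<noteq> {}"
      using split_Un[OF a] 1(5,6) by blast
    then show ?thesis
      using 1(1)[OF False _ refl refl refl refl refl refl refl]
        1(2)[OF False _ refl refl refl refl refl refl refl] a gc False \<open>finite S\<close>
      by (subst ptcp.simps) (auto simp: Let_def)
  qed
qed

end

theory Submission
  imports Defs
begin

text \<open>PTCP assigns every request a home server determined by its position, and uses the nearest
  free server to the left of the home, or, if there is none, the first free server to its right.
  Let \<open>h p\<close> be the number of requests that PTCP has served left of the gap \<open>p\<close> minus the number
  served there by a fixed optimal matching. The potential is
  \<open>\<Sum>\<^sub>p D\<^sub>p (2 m\<^sub>p - h p)\<close>, where \<open>D\<^sub>p\<close> is the length of the gap and \<open>m \<ge> max 0 h\<close> is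
  nonincreasing to the right of the first free server. It is the cost of transporting PTCP's
  surplus to the optimum's when mass can move rightwards only after a detour via the first free
  server. A request is split into a fictitious service by its home, whose effect on the potential is
  at most 5 times the optimal cost, and a move from the home to the server actually used, which
  the potential pays for exactly because all servers passed are full.

  In the set \<open>{0, 2, 4}\<close> the largest gap is not unique. If the recursion cuts it at \<open>{0}\<close>,
  home 2 prefers 4 to 0 as long as both are free, and during this phase a different potential
  is used on the first two gaps.

  For greedy, fill all servers up to one unit, then issue requests slightly to the right of
  \<open>1, 2, 4, \<dots>\<close>, each of which is pushed to the next server, until the last one must return to \<open>0\<close>.\<close>

section \<open>Surplus of one assignment over another, counted left of each gap\<close>

definition step_at :: "nat \<Rightarrow> nat \<Rightarrow> int" where
  "step_at j p = (if j \<le> p then 1 else 0)"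

definition surplus :: "(nat \<Rightarrow> nat) \<Rightarrow> (nat \<Rightarrow> nat) \<Rightarrow> nat \<Rightarrow> int" where
  "surplus x y p = (\<Sum>i=1..p. int (x i) - int (y i))"

lemma surplus_left_Suc:
  "1 \<le> a \<Longrightarrow> surplus (x(a := Suc (x a))) y = (\<lambda>p. surplus x y p + step_at a p)"
proof
  fix p assume a: "1 \<le> a"
  have "surplus (x(a := Suc (x a))) y p =
      (\<Sum>i=1..p. (int (x i) - int (y i)) + (if i = a then 1 else 0))"
    unfolding surplus_def by (intro sum.cong) auto
  then show "surplus (x(a := Suc (x a))) y p = surplus x y p + step_at a p"
    using a by (simp add: surplus_def step_at_def sum.distrib)
qed

lemma surplus_right_Suc:
  "1 \<le> a \<Longrightarrow> surplus x (y(a := Suc (y a))) = (\<lambda>p. surplus x y p - step_at a p)"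
proof
  fix p assume a: "1 \<le> a"
  have "surplus x (y(a := Suc (y a))) p =
      (\<Sum>i=1..p. (int (x i) - int (y i)) - (if i = a then 1 else 0))"
    unfolding surplus_def by (intro sum.cong) auto
  then show "surplus x (y(a := Suc (y a))) p = surplus x y p - step_at a p"
    using a by (simp add: surplus_def step_at_def sum_subtractf)
qed

lemma surplus_0 [simp]: "surplus x y 0 = 0"
  by (simp add: surplus_def)

lemma surplus_split: "p \<le> q \<Longrightarrow> surplus x y q = surplus x y p + (\<Sum>i\<in>{p<..q}. int (x i) - int (y i))"
proof -
  assume "p \<le> q"
  then have eq: "{1..q} = {1..p} \<union> {p<..q}" by auto
  show ?thesis unfolding surplus_def eq by (rule sum.union_disjoint) auto
qed

lemma surplus_le:
  assumes "p \<le> q" "\<And>i. i \<in> {p<..q} \<Longrightarrow> y i \<le> x i"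
  shows "surplus x y p \<le> surplus x y q"
proof -
  have "0 \<le> (\<Sum>i\<in>{p<..q}. int (x i) - int (y i))"
    using assms by (intro sum_nonneg) auto
  then show ?thesis using surplus_split[OF assms(1), of x y] by linarith
qed

text \<open>Used where the servers between \<open>p\<close> and \<open>q\<close> are full: they hold
  at least as many of PTCP's requests as of the optimum's. The strict term is usually the extra
  request booked at the home.\<close>

lemma surplus_less:
  assumes "\<And>i. i \<in> {p<..q} \<Longrightarrow> y i \<le> x i" "j \<in> {p<..q}" "y j < x j"
  shows "surplus x y p < surplus x y q"
proof -
  have "0 < (\<Sum>i\<in>{p<..q}. int (x i) - int (y i))"
    using assms by (intro sum_pos2[of _ j]) auto
  then show ?thesis using surplus_split[of p q x y] assms(2) by auto
qed

text \<open>In the indexed view, \<open>F\<close> is the set of free servers, \<open>j\<close> the home and \<open>a\<close> the server used.\<close>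

definition pick :: "nat set \<Rightarrow> nat \<Rightarrow> nat \<Rightarrow> bool" where
  "pick F j a \<longleftrightarrow> a \<in> F \<and>
     (a \<le> j \<and> (\<forall>i. a < i \<and> i \<le> j \<longrightarrow> i \<notin> F) \<or> j < a \<and> (\<forall>i<a. i \<notin> F))"

subsection \<open>Matchings\<close>

lemma load_append: "load (M @ [(r, v)]) w = load M w + (if v = w then 1 else 0)"
  by (simp add: load_def)

lemma match_cost_append: "match_cost (M @ N) = match_cost M + match_cost N"
  by (simp add: match_cost_def)

lemma match_cost_Cons: "match_cost ((r, v) # M) = \<bar>r - v\<bar> + match_cost M"
  by (simp add: match_cost_def)

lemma match_cost_Nil: "match_cost [] = 0"
  by (simp add: match_cost_def)

lemma load_append_mono: "load M v \<le> load (M @ N) v"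
  by (simp add: load_def)

lemma sum_load:
  assumes "finite S" "snd ` set M \<subseteq> S"
  shows "(\<Sum>v\<in>S. load M v) = length M"
  using sum_count_set[of "map snd M" S] assms by (simp add: load_def)

lemma free_nonempty:
  assumes "finite S" "snd ` set M \<subseteq> S" "length M < (\<Sum>v\<in>S. c v)"
  shows "free S c M \<noteq> {}"
proof
  assume "free S c M = {}"
  then have "c v \<le> load M v" if "v \<in> S" for v using that by (force simp: free_def)
  then have "(\<Sum>v\<in>S. c v) \<le> length M"
    using sum_mono[of S c "load M"] sum_load[OF assms(1,2)] by simp
  then show False using assms(3) by simp
qed

lemma finite_matchings:
  assumes "finite S"
  shows "finite (matchings S c \<sigma>)"
proof (rule finite_subset)
  show "matchings S c \<sigma> \<subseteq> {M. set M \<subseteq> set \<sigma> \<times> S \<and> length M = length \<sigma>}"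
    by (force simp: matchings_def)
  show "finite {M. set M \<subseteq> set \<sigma> \<times> S \<and> length M = length \<sigma>}"
    using assms by (intro finite_lists_length_eq) auto
qed

lemma serve_in_matchings:
  assumes A: "\<And>M r. free S c M \<noteq> {} \<Longrightarrow> A M r \<in> free S c M" and "finite S"
    and M: "snd ` set M \<subseteq> S" "\<And>v. v \<in> S \<Longrightarrow> load M v \<le> c v"
    and len: "length M + length \<sigma> \<le> (\<Sum>v\<in>S. c v)"
  shows "serve A M \<sigma> \<in> matchings S c (map fst M @ \<sigma>)"
  using M len
proof (induction \<sigma> arbitrary: M)
  case Nil
  then show ?case by (simp add: matchings_def)
next
  case (Cons r \<sigma>)
  have "free S c M \<noteq> {}" using Cons.prems \<open>finite S\<close> by (intro free_nonempty) auto
  then have a: "A M r \<in> S" "load M (A M r) < c (A M r)"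
    using A[of M r] by (auto simp: free_def)
  have "serve A (M @ [(r, A M r)]) \<sigma> \<in> matchings S c (map fst (M @ [(r, A M r)]) @ \<sigma>)"
    using Cons.prems a by (intro Cons.IH) (auto simp: load_append)
  then show ?case by simp
qed

lemma Opt_le:
  assumes "finite S" "M \<in> matchings S c \<sigma>"
  shows "Opt S c \<sigma> \<le> match_cost M"
  using assms finite_matchings[of S c \<sigma>] unfolding Opt_def by (intro Min_le) auto

lemma Opt_attained:
  assumes "finite S" "matchings S c \<sigma> \<noteq> {}"
  obtains N where "N \<in> matchings S c \<sigma>" "match_cost N = Opt S c \<sigma>"
proof -
  have "Opt S c \<sigma> \<in> match_cost ` matchings S c \<sigma>"
    unfolding Opt_def using assms finite_matchings[of S c \<sigma>] by (intro Min_in) auto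
  then show thesis using that by force
qed

subsection \<open>The potential for servers on a line\<close>

locale line_servers =
  fixes k :: nat and s :: "nat \<Rightarrow> real"
  assumes k_pos: "1 \<le> k"
    and s_1: "s 1 = 0"
    and s_less: "\<And>i j. 1 \<le> i \<Longrightarrow> i < j \<Longrightarrow> j \<le> k \<Longrightarrow> s i < s j"
begin

lemma s_le: "1 \<le> i \<Longrightarrow> i \<le> j \<Longrightarrow> j \<le> k \<Longrightarrow> s i \<le> s j"
  using s_less[of i j] by (cases "i = j") auto

lemma inj_s: "inj_on s {1..k}"
  by (intro inj_onI) (metis atLeastAtMost_iff linorder_neqE_nat order_less_irrefl s_less)

definition gap_sum :: "(nat \<Rightarrow> int) \<Rightarrow> real" where
  "gap_sum f = (\<Sum>p=1..<k. (s (Suc p) - s p) * real_of_int (f p))"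

lemma gap_sum_add: "gap_sum (\<lambda>p. f p + g p) = gap_sum f + gap_sum g"
  by (simp add: gap_sum_def distrib_left sum.distrib)

lemma gap_sum_diff: "gap_sum (\<lambda>p. f p - g p) = gap_sum f - gap_sum g"
  by (simp add: gap_sum_def right_diff_distrib sum_subtractf)

lemma gap_sum_cmult: "gap_sum (\<lambda>p. b * f p) = of_int b * gap_sum f"
  by (simp add: gap_sum_def sum_distrib_left mult_ac)

text \<open>The gap lengths telescope. Every change of \<open>h\<close> or \<open>m\<close> below is
  a combination of steps, so this and linearity evaluate each change of the potential.\<close>

lemma gap_sum_step_at:
  assumes "1 \<le> j" "j \<le> k"
  shows "gap_sum (step_at j) = s k - s j"
proof -
  have "gap_sum (step_at j) = (\<Sum>p=j..<k. s (Suc p) - s p)"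
    unfolding gap_sum_def using assms
    by (intro sum.mono_neutral_cong_right) (auto simp: step_at_def)
  then show ?thesis using sum_Suc_diff'[OF assms(2), of s] by simp
qed

lemmas gap_sum_simps = gap_sum_add gap_sum_diff gap_sum_cmult gap_sum_step_at

definition pot :: "(nat \<Rightarrow> int) \<Rightarrow> (nat \<Rightarrow> int) \<Rightarrow> real" where
  "pot h m = 2 * gap_sum m - gap_sum h"

text \<open>Any admissible \<open>m\<close> is allowed, not only the least one, so that preserving
  the invariant means exhibiting a suitable \<open>m\<close>. Index \<open>k\<close> carries no
  weight in \<open>pot\<close> but is constrained too: \<open>witness_move\<close> compares
  \<open>h\<close> with \<open>m\<close> at the home, which may be \<open>k\<close>.\<close>

definition witness :: "(nat \<Rightarrow> bool) \<Rightarrow> (nat \<Rightarrow> int) \<Rightarrow> (nat \<Rightarrow> int) \<Rightarrow> bool" where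
  "witness full h m \<longleftrightarrow> (\<forall>p\<in>{1..k}. 0 \<le> m p \<and> h p \<le> m p) \<and>
     (\<forall>p\<in>{1..<k}. (\<exists>i\<in>{1..p}. \<not> full i) \<longrightarrow> m (Suc p) \<le> m p)"

lemma witness_antimono:
  assumes "witness full h m" "\<not> full i" "1 \<le> i" "i \<le> p" "p \<le> q" "q \<le> k"
  shows "m q \<le> m p"
  using assms(5,6)
proof (induction q rule: dec_induct)
  case (step q)
  have "i \<in> {1..q}" "q \<in> {1..<k}" using step assms by auto
  then have "m (Suc q) \<le> m q" using assms(1,2) unfolding witness_def by blast
  then show ?case using step by simp
qed simp

lemma pot_nonneg:
  assumes "witness full h m"
  shows "0 \<le> pot h m"
proof -
  have "pot h m = (\<Sum>p=1..<k. (s (Suc p) - s p) * real_of_int (2 * m p - h p))"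
    unfolding pot_def gap_sum_cmult[symmetric, of 2, simplified] gap_sum_diff[symmetric]
    by (simp add: gap_sum_def)
  moreover have "0 \<le> (s (Suc p) - s p) * real_of_int (2 * m p - h p)" if "p \<in> {1..<k}" for p
  proof -
    have "0 \<le> m p" "h p \<le> m p" using assms that by (auto simp: witness_def)
    then have "0 \<le> 2 * m p - h p" by linarith
    then show ?thesis using that s_less[of p "Suc p"] by (intro mult_nonneg_nonneg) auto
  qed
  ultimately show ?thesis by (metis (no_types, lifting) sum_nonneg)
qed

text \<open>For \<open>q \<le> j\<close> the surplus only drops, and \<open>m\<close> can stay. For
  \<open>j < q\<close> the surplus rises between \<open>j\<close> and \<open>q\<close>, and
  \<open>m\<close> is raised on all gaps left of \<open>q\<close>, so that it stays nonincreasing: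
  this costs \<open>2 * s q\<close> for \<open>m\<close>, of which the rise of \<open>h\<close>
  gives back \<open>s q - s j\<close>.\<close>

lemma witness_virtual:
  assumes "witness full h m" "j \<in> {1..k}" "q \<in> {1..k}"
  obtains m' where "witness full (\<lambda>p. h p + step_at j p - step_at q p) m'"
    "pot (\<lambda>p. h p + step_at j p - step_at q p) m' \<le> pot h m + (if q \<le> j then s j - s q else s j + s q)"
proof (cases "q \<le> j")
  case True
  have "h p + step_at j p - step_at q p \<le> h p" for p
    using True by (simp add: step_at_def)
  then have "witness full (\<lambda>p. h p + step_at j p - step_at q p) m"
    using assms(1) unfolding witness_def by (meson order_trans)
  moreover have "pot (\<lambda>p. h p + step_at j p - step_at q p) m = pot h m + s j - s q"
    using assms by (simp add: pot_def gap_sum_simps)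
  ultimately show ?thesis using that[of m] True by simp
next
  case False
  let ?m = "\<lambda>p. m p + (step_at 1 p - step_at q p)"
  have "0 \<le> ?m p \<and> h p + step_at j p - step_at q p \<le> ?m p" if "p \<in> {1..k}" for p
  proof -
    have "0 \<le> m p" "h p \<le> m p" using assms(1) that by (auto simp: witness_def)
    then show ?thesis using False that by (auto simp: step_at_def)
  qed
  moreover have "?m (Suc p) \<le> ?m p" if "p \<in> {1..<k}" "\<exists>i\<in>{1..p}. \<not> full i" for p
  proof -
    have "m (Suc p) \<le> m p" using assms(1) that by (auto simp: witness_def)
    then show ?thesis using that by (auto simp: step_at_def)
  qed
  ultimately have "witness full (\<lambda>p. h p + step_at j p - step_at q p) ?m"
    unfolding witness_def by blast
  moreover have "pot (\<lambda>p. h p + step_at j p - step_at q p) ?m = pot h m + s j + s q"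
    using assms k_pos s_1 by (simp add: pot_def gap_sum_simps)
  ultimately show ?thesis using that[of ?m] False by simp
qed

text \<open>The unit booked at the home \<open>j\<close> is carried to the server \<open>a\<close>,
  and the potential pays the distance. Fullness refers to the loads before the request, while the
  surplus already contains the unit at \<open>j\<close>, which may exceed the capacity
  there.\<close>

lemma witness_move:
  assumes w: "witness (\<lambda>i. c i \<le> x i) (surplus (x(j := Suc (x j))) y) m"
    and x: "\<And>i. i \<in> {1..k} \<Longrightarrow> x i \<le> c i"
    and y: "\<And>i. i \<in> {1..k} \<Longrightarrow> y i \<le> c i"
    and pick: "pick {i \<in> {1..k}. x i < c i} j a" and j: "j \<in> {1..k}"
  obtains m' where "witness (\<lambda>i. c i \<le> (x(a := Suc (x a))) i) (surplus (x(a := Suc (x a))) y) m'"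
    "pot (surplus (x(a := Suc (x a))) y) m' + \<bar>s a - s j\<bar> \<le> pot (surplus (x(j := Suc (x j))) y) m"
proof -
  define xv where "xv = x(j := Suc (x j))"
  define h where "h = surplus xv y"
  define h' where "h' = surplus (x(a := Suc (x a))) y"
  have a: "a \<in> {1..k}" "x a < c a" using pick by (auto simp: pick_def)
  have le_upd: "x i \<le> (x(a := Suc (x a))) i" for i by simp
  have h': "h' = (\<lambda>p. h p + step_at a p - step_at j p)"
    using a j by (simp add: h_def h'_def xv_def surplus_left_Suc)
  have pot': "pot h' m' = 2 * gap_sum m' - gap_sum h + s a - s j" for m'
    using a j by (simp add: pot_def h' gap_sum_simps)
  consider "a \<le> j" "\<forall>i. a < i \<and> i \<le> j \<longrightarrow> x i = c i" | "j < a" "\<forall>i\<in>{1..<a}. x i = c i"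
  proof -
    have full: "x i = c i" if "i \<in> {1..k}" "i \<notin> {i \<in> {1..k}. x i < c i}" for i
      using that x[of i] by simp
    show thesis
    proof (cases "a \<le> j")
      case True
      have "x i = c i" if "a < i" "i \<le> j" for i
        using pick full[of i] True that a j by (simp add: pick_def)
      then show thesis using True that(1) by blast
    next
      case False
      have "x i = c i" if "i \<in> {1..<a}" for i
        using pick full[of i] False that a by (simp add: pick_def)
      then show thesis using False that(2) by simp
    qed
  qed
  then show ?thesis
  proof cases
    case 1
    \<comment> \<open>The servers after \<open>p\<close> up to \<open>j\<close> are full and
      \<open>j\<close> holds the booked unit on top, so \<open>h\<close> grows strictly towards
      \<open>j\<close>. As \<open>a\<close> was still free, \<open>m\<close> is nonincreasing from
      \<open>a\<close> on. The resulting slack absorbs the rise of \<open>h\<close> by one, with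
      \<open>m\<close> unchanged.\<close>
    have "h p < m p" if p: "a \<le> p" "p < j" for p
    proof -
      have "h p < h j" unfolding h_def 
      proof (rule surplus_less[of p j _ _ j])
        show "y i \<le> xv i" if "i \<in> {p<..j}" for i
          using that p 1 y[of i] j a by (auto simp: xv_def)
        show "y j < xv j" using p 1 y[of j] j by (auto simp: xv_def)
      qed (use p in auto)
      also have "h j \<le> m j" using w j by (simp add: witness_def h_def xv_def)
      also have "m j \<le> m p" using witness_antimono[OF w, of a p j] a p j by auto
      finally show ?thesis .
    qed
    note less = this
    have "h' p \<le> m p" if "p \<in> {1..k}" for p
    proof -
      have "h p \<le> m p" using w that by (simp add: witness_def h_def xv_def)
      then show ?thesis using less[of p] 1(1) by (auto simp: h' step_at_def)
    qed
    moreover have "\<exists>i\<in>{1..p}. \<not> c i \<le> x i"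
      if "\<exists>i\<in>{1..p}. \<not> c i \<le> (x(a := Suc (x a))) i" for p
      using that le_upd by (meson order_trans)
    ultimately have "witness (\<lambda>i. c i \<le> (x(a := Suc (x a))) i) h' m"
      using w unfolding witness_def by blast
    moreover have "pot h' m + \<bar>s a - s j\<bar> \<le> pot h m"
      using pot'[of m] s_le[of a j] 1 a j by (simp add: pot_def)
    ultimately show ?thesis using that by (simp add: h_def h'_def xv_def)
  next
    case 2
    \<comment> \<open>On the gaps between \<open>j\<close> and \<open>a\<close> the surplus is
      positive, so \<open>m\<close> can be lowered there together with \<open>h\<close>. The
      potential loses twice the distance through \<open>m\<close> and regains it once through
      \<open>h\<close>.\<close>
    let ?m = "\<lambda>p. m p - (step_at j p - step_at a p)"
    have pos: "0 < h p" if p: "j \<le> p" "p < a" for p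
    proof -
      have "surplus xv y 0 < h p" unfolding h_def 
      proof (rule surplus_less[of 0 p _ _ j])
        show "y i \<le> xv i" if "i \<in> {0<..p}" for i
          using that p 2 y[of i] a by (auto simp: xv_def)
        show "y j < xv j" using p 2 y[of j] j by (auto simp: xv_def)
      qed (use p j in auto)
      then show ?thesis by simp
    qed
    have "0 \<le> ?m p \<and> h' p \<le> ?m p" if "p \<in> {1..k}" for p
    proof -
      have "0 \<le> m p" "h p \<le> m p" using w that by (auto simp: witness_def h_def xv_def)
      then show ?thesis using pos[of p] 2(1) by (auto simp: h' step_at_def)
    qed
    moreover have "?m (Suc p) \<le> ?m p" if p: "p \<in> {1..<k}" and nonfull: "\<exists>i\<in>{1..p}. \<not> c i \<le> (x(a := Suc (x a))) i" for p
    proof -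
      obtain i where i: "i \<in> {1..p}" "x i < c i"
        using nonfull le_upd by (meson order_trans not_le)
      \<comment> \<open>Everything left of \<open>a\<close> is full, so the upward jump of
        \<open>?m\<close> at \<open>a\<close> is subject to no monotonicity condition.\<close>
      then have "a \<le> i" using 2 by force
      then have "a \<le> p" using i by simp
      moreover have "m (Suc p) \<le> m p" using w p i unfolding witness_def by (meson not_le)
      ultimately show ?thesis using 2(1) by (simp add: step_at_def)
    qed
    ultimately have "witness (\<lambda>i. c i \<le> (x(a := Suc (x a))) i) h' ?m"
      unfolding witness_def by blast
    moreover have "pot h' ?m + \<bar>s a - s j\<bar> \<le> pot h m"
      using pot'[of ?m] s_less[of j a] 2 a j by (simp add: pot_def gap_sum_simps)
    ultimately show ?thesis using that by (simp add: h_def h'_def xv_def)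
  qed
qed

end

subsection \<open>The potential for an ambiguous first cut\<close>

locale doubling_servers =
  fixes k :: nat and s :: "nat \<Rightarrow> real"
  assumes k_pos: "1 \<le> k"
    and s_1: "s 1 = 0"
    and s_power: "\<And>i. i \<in> {2..k} \<Longrightarrow> s i = 2 ^ (i - 1)"

sublocale doubling_servers \<subseteq> line_servers
proof
  fix i j :: nat
  assume ij: "1 \<le> i" "i < j" "j \<le> k"
  show "s i < s j"
  proof (cases "i = 1")
    case True
    then show ?thesis using ij s_1 s_power[of j] by simp
  next
    case False
    then show ?thesis using ij s_power[of i] s_power[of j] by simp
  qed
qed (fact k_pos s_1)+

context doubling_servers
begin

lemma s_Suc: "2 \<le> i \<Longrightarrow> Suc i \<le> k \<Longrightarrow> s (Suc i) = 2 * s i"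
  using s_power[of i] s_power[of "Suc i"] by (cases i) auto

lemma s_2: "2 \<le> k \<Longrightarrow> s 2 = 2"
  using s_power[of 2] by simp

lemma s_3: "3 \<le> k \<Longrightarrow> s 3 = 4"
  using s_power[of 3] by simp

lemma s_ge_8: "4 \<le> i \<Longrightarrow> i \<le> k \<Longrightarrow> 8 \<le> s i"
  using s_power[of i] power_increasing[of 3 "i - 1" "2::real"] by simp

lemma s_nonneg: "1 \<le> i \<Longrightarrow> i \<le> k \<Longrightarrow> 0 \<le> s i"
  using s_le[of 1 i] s_1 by simp

lemma double_s_le:
  assumes "1 \<le> i" "i < j" "j \<le> k"
  shows "2 * s i \<le> s j"
proof (cases "i = 1")
  case True
  then show ?thesis using s_1 s_nonneg[of j] assms by simp
next
  case False
  then have "2 * s i = s (Suc i)" using assms s_Suc[of i] by simp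
  also have "\<dots> \<le> s j" using assms s_le[of "Suc i" j] by simp
  finally show ?thesis .
qed

text \<open>The invariant while 0 and 4 are both free and \<open>{0, 2, 4}\<close> is cut at \<open>{0}\<close>. With
  \<open>E = max 0 (m 3 - h 1)\<close> units going down from 4 to 0 directly, the last four
  conditions say \<open>m 2 \<ge> max (m 3 + E) (h 2 + 2 E)\<close>; normalizing \<open>m 1 = h 1\<close> allows the
  same potential to be used in both phases.\<close>

definition tie_witness :: "(nat \<Rightarrow> int) \<Rightarrow> (nat \<Rightarrow> int) \<Rightarrow> bool" where
  "tie_witness h m \<longleftrightarrow> (\<forall>p\<in>{3..k}. 0 \<le> m p \<and> h p \<le> m p) \<and>
     (\<forall>p\<in>{3..<k}. m (Suc p) \<le> m p) \<and> m 1 = h 1 \<and> m 3 \<le> m 2 \<and> 2 * m 3 - h 1 \<le> m 2 \<and>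
     h 2 \<le> m 2 \<and> h 2 + 2 * m 3 - 2 * h 1 \<le> m 2"

text \<open>Bounds the growth of the potential when PTCP uses \<open>j\<close> and the optimum uses \<open>q\<close>. From 2, mass
  reaches 0 only via 4, whence the detours of length 6.\<close>

definition tie_dist :: "nat \<Rightarrow> nat \<Rightarrow> real" where
  "tie_dist j q = (if j = 2 \<and> q = 1 then 6 else if j = 2 \<and> q = 3 then 2
     else if j = 2 \<and> 4 \<le> q then 6 + s q
     else if q \<le> j then s j - s q else s j + s q)"

text \<open>The largest increase among the four lower bounds on \<open>m 2\<close> in
  \<open>tie_witness\<close> when \<open>j\<close> is booked against \<open>q\<close> and
  \<open>m 3\<close> grows by one in the case \<open>4 \<le> q\<close>,
  \<open>j < q\<close>.\<close>

definition tie_shift :: "nat \<Rightarrow> nat \<Rightarrow> int" where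
  "tie_shift j q = (if q = j then 0
    else if q = 1 then (if j = 2 then 2 else 1)
    else if q = 2 then 0
    else if q = 3 then (if j < 3 then 1 else 0)
    else if j = 1 then 1 else if j = 2 then 3 else if j = 3 then 2 else if j < q then 2 else 0)"

lemma tie_witness_virtual:
  assumes k: "3 \<le> k" and w: "tie_witness h m" and jq: "j \<in> {1..k}" "q \<in> {1..k}"
  obtains m' where "tie_witness (\<lambda>p. h p + step_at j p - step_at q p) m'"
    "pot (\<lambda>p. h p + step_at j p - step_at q p) m' \<le> pot h m + tie_dist j q"
proof -
  define \<alpha> where "\<alpha> = step_at j 1 - step_at q 1"
  define \<epsilon> :: int where "\<epsilon> = (if 4 \<le> q \<and> j < q then 1 else 0)"
  \<comment> \<open>Differences of steps isolate the indices: index 1 follows \<open>h 1\<close>,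
    index 2 grows by \<open>tie_shift\<close>, and indices 3 to \<open>q - 1\<close> grow by
    \<epsilon>. Starting at 3 rather than at \<open>j\<close> keeps \<open>m'\<close> nonincreasing
    from 3 on.\<close>
  define m' where "m' = (\<lambda>p. m p + \<alpha> * (step_at 1 p - step_at 2 p)
    + tie_shift j q * (step_at 2 p - step_at 3 p) + \<epsilon> * (step_at 3 p - step_at q p))"
  let ?h = "\<lambda>p. h p + step_at j p - step_at q p"
  have small: "m' 1 = m 1 + \<alpha>" "m' 2 = m 2 + tie_shift j q" "m' 3 = m 3 + \<epsilon>"
    by (auto simp: m'_def step_at_def \<epsilon>_def)
  have large: "m' p = m p + \<epsilon> * (step_at 3 p - step_at q p)" if "3 \<le> p" for p
    using that by (simp add: m'_def step_at_def)
  have w12: "m 1 = h 1" "m 3 \<le> m 2" "2 * m 3 - h 1 \<le> m 2" "h 2 \<le> m 2" "h 2 + 2 * m 3 - 2 * h 1 \<le> m 2"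
    using w by (auto simp: tie_witness_def)
  have "m' 1 = ?h 1" using w12 small by (simp add: \<alpha>_def)
  moreover have "m' 3 \<le> m' 2 \<and> 2 * m' 3 - ?h 1 \<le> m' 2 \<and> ?h 2 \<le> m' 2 \<and> ?h 2 + 2 * m' 3 - 2 * ?h 1 \<le> m' 2"
    using w12 jq unfolding small by (simp add: tie_shift_def \<epsilon>_def step_at_def)
  moreover have "0 \<le> m' p \<and> ?h p \<le> m' p" if "p \<in> {3..k}" for p
  proof -
    have "0 \<le> m p" "h p \<le> m p" using w that by (auto simp: tie_witness_def)
    then show ?thesis using that large[of p] by (auto simp: step_at_def \<epsilon>_def)
  qed
  moreover have "m' (Suc p) \<le> m' p" if "p \<in> {3..<k}" for p
  proof -
    have "m (Suc p) \<le> m p" using w that by (auto simp: tie_witness_def)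
    then show ?thesis using that large[of p] large[of "Suc p"] by (auto simp: step_at_def \<epsilon>_def)
  qed
  ultimately have "tie_witness ?h m'" by (simp add: tie_witness_def)
  \<comment> \<open>The first two gaps have length 2 and \<open>m\<close> counts twice, hence the
    factors 4.\<close>
  moreover have "pot ?h m' = pot h m + 4 * \<alpha> + 4 * tie_shift j q + 2 * \<epsilon> * (s q - 4) + s j - s q"
    using jq k s_1 s_2 s_3 by (simp add: pot_def m'_def gap_sum_simps algebra_simps)
  moreover have "4 * \<alpha> + 4 * tie_shift j q + 2 * \<epsilon> * (s q - 4) + s j - s q \<le> tie_dist j q"
  proof -
    have "j = 1 \<or> j = 2 \<or> j = 3 \<or> 4 \<le> j" "q = 1 \<or> q = 2 \<or> q = 3 \<or> 4 \<le> q"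
      using jq by auto
    then show ?thesis using k s_1 s_2 s_3
      by (elim disjE) (auto simp: tie_dist_def tie_shift_def \<alpha>_def \<epsilon>_def step_at_def)
  qed
  ultimately show ?thesis using that[of m'] by linarith
qed

lemma tie_witness_move:
  assumes k: "3 \<le> k" and w: "tie_witness (surplus (x(j := Suc (x j))) y) m"
    and x: "\<And>i. i \<in> {1..k} \<Longrightarrow> x i \<le> c i"
    and y: "\<And>i. i \<in> {1..k} \<Longrightarrow> y i \<le> c i"
    and free: "x 1 < c 1" "x 3 < c 3"
    and pick: "if j = 2 then a = (if x 2 < c 2 then 2 else 3) else pick {i \<in> {1..k}. x i < c i} j a"
    and j: "j \<in> {1..k}"
  obtains m' where "tie_witness (surplus (x(a := Suc (x a))) y) m'"
    "pot (surplus (x(a := Suc (x a))) y) m' + \<bar>s a - s j\<bar> \<le> pot (surplus (x(j := Suc (x j))) y) m"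
proof -
  define xv where "xv = x(j := Suc (x j))"
  define h where "h = surplus xv y"
  define h' where "h' = surplus (x(a := Suc (x a))) y"
  have w: "tie_witness h m" using w by (simp add: h_def xv_def)
  have a: "a \<in> {1..k}" using pick k by (auto simp: pick_def split: if_splits)
  have h': "h' = (\<lambda>p. h p + step_at a p - step_at j p)"
    using a j by (simp add: h_def h'_def xv_def surplus_left_Suc)
  have pot': "pot h' m' = 2 * gap_sum m' - gap_sum h + s a - s j" for m'
    using a j by (simp add: pot_def h' gap_sum_simps)
  have in_F: "1 \<in> {i \<in> {1..k}. x i < c i}" "3 \<in> {i \<in> {1..k}. x i < c i}" using free k by auto
  \<comment> \<open>With 0 free, only home 2 can be pushed to the right; with 4 free, no home at or
    beyond 4 is pushed to the left of 4.\<close>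
  consider "a = j" | "j = 2" "a = 3" "x 2 = c 2" | "3 \<le> a" "a < j" "\<forall>i. a < i \<and> i \<le> j \<longrightarrow> x i = c i"
  proof (cases "j = 2")
    case True
    show thesis
    proof (cases "x 2 < c 2")
      case True
      then show thesis using that(1) pick \<open>j = 2\<close> by simp
    next
      case False
      then show thesis using that(2) pick \<open>j = 2\<close> x[of 2] k by simp
    qed
  next
    case False
    then have p: "pick {i \<in> {1..k}. x i < c i} j a" using pick by simp
    have "\<not> j < a"
    proof
      assume "j < a"
      then have "\<forall>i<a. i \<notin> {i \<in> {1..k}. x i < c i}" using p by (simp add: pick_def)
      then have "\<not> 1 < a" using in_F(1) by blast
      then show False using \<open>j < a\<close> j by simp
    qed
    then have desc: "a \<le> j" "\<forall>i. a < i \<and> i \<le> j \<longrightarrow> i \<notin> {i \<in> {1..k}. x i < c i}"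
      using p by (auto simp: pick_def)
    show thesis
    proof (cases "a = j")
      case True
      then show thesis using that by simp
    next
      case neq: False
      have "3 \<le> a"
      proof (rule ccontr)
        assume "\<not> 3 \<le> a"
        then have "\<not> 3 \<le> j" using desc(2) in_F(2) by (meson not_le)
        then show False using neq desc False a by auto
      qed
      moreover have "x i = c i" if "a < i" "i \<le> j" for i
      proof -
        have "i \<notin> {i \<in> {1..k}. x i < c i}" using desc(2) that by blast
        then show ?thesis using x[of i] that j by simp
      qed
      ultimately show thesis using that neq desc by simp
    qed
  qed
  then show ?thesis
  proof cases
    case 1
    then show ?thesis using that[of m] w by (simp add: h_def xv_def)
  next
    case 2
    \<comment> \<open>Lowering \<open>m 2\<close> keeps pace with \<open>h 2\<close>. The two lower
      bounds that do not contain \<open>h 2\<close> have slack, because the booked unit at the full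
      server 2 makes \<open>h 1 < h 2\<close>.\<close>
    let ?m = "\<lambda>p. m p - (step_at 2 p - step_at 3 p)"
    have "h 1 < h 2" unfolding h_def
    proof (rule surplus_less[of 1 2 _ _ 2])
      show "y i \<le> xv i" if "i \<in> {1<..2}" for i
      proof -
        have "i = 2" using that by auto
        then show ?thesis using 2 y[of 2] k by (simp add: xv_def)
      qed
    qed (use 2 y[of 2] k in \<open>auto simp: xv_def\<close>)
    then have "tie_witness h' ?m"
      using w unfolding tie_witness_def h' 2 by (auto simp: step_at_def)
    moreover have "pot h' ?m + \<bar>s a - s j\<bar> \<le> pot h m"
      using pot'[of ?m] k s_2 s_3 2 by (simp add: pot_def gap_sum_simps)
    ultimately show ?thesis using that by (simp add: h_def h'_def xv_def)
  next
    case 3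
    have mono: "m q \<le> m p" if "3 \<le> p" "p \<le> q" "q \<le> k" for p q
      using that(2,3)
    proof (induction q rule: dec_induct)
      case (step q)
      then have "m (Suc q) \<le> m q" using w that(1) by (simp add: tie_witness_def)
      then show ?case using step by simp
    qed simp
    have less: "h p < m p" if p: "a \<le> p" "p < j" for p
    proof -
      have "h p < h j" unfolding h_def
      proof (rule surplus_less[of p j _ _ j])
        show "y i \<le> xv i" if "i \<in> {p<..j}" for i
          using that p 3 y[of i] j a by (auto simp: xv_def)
        show "y j < xv j" using p 3 y[of j] j by (auto simp: xv_def)
      qed (use p in auto)
      also have "h j \<le> m j" using w j 3 by (simp add: tie_witness_def)
      also have "m j \<le> m p" using mono[of p j] 3 p j by auto
      finally show ?thesis .
    qed
    have "h' p \<le> m p" if "p \<in> {3..k}" for p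
    proof -
      have "h p \<le> m p" using w that by (simp add: tie_witness_def)
      then show ?thesis using less[of p] 3(2) by (auto simp: h' step_at_def)
    qed
    moreover have "h' 1 = h 1" "h' 2 = h 2" using 3 by (auto simp: h' step_at_def)
    ultimately have "tie_witness h' m" using w by (simp add: tie_witness_def)
    moreover have "pot h' m + \<bar>s a - s j\<bar> \<le> pot h m"
      using pot'[of m] s_le[of a j] 3 a j by (simp add: pot_def)
    ultimately show ?thesis using that by (simp add: h_def h'_def xv_def)
  qed
qed

text \<open>The change of phase costs nothing. If 0 is full, \<open>m\<close> itself serves, as
  nothing is required between its first two values. If 4 is full, weight is exchanged between the
  first two gaps, which have equal length.\<close>

lemma tie_witness_imp_witness:
  assumes k: "3 \<le> k" and w: "tie_witness h m" and full: "full 1 \<and> 0 \<le> h 1 \<or> full 3 \<and> h 2 \<le> h 3"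
  obtains m' where "witness full h m'" "pot h m' \<le> pot h m"
proof -
  have w12: "m 1 = h 1" "m 3 \<le> m 2" "2 * m 3 - h 1 \<le> m 2" "h 2 \<le> m 2" "h 2 + 2 * m 3 - 2 * h 1 \<le> m 2"
    and w3: "0 \<le> m 3" "h 3 \<le> m 3"
    using w k by (auto simp: tie_witness_def)
  have large: "0 \<le> m p \<and> h p \<le> m p" if "3 \<le> p" "p \<le> k" for p
    using w that by (simp add: tie_witness_def)
  have mono: "m (Suc p) \<le> m p" if "3 \<le> p" "p < k" for p
    using w that by (simp add: tie_witness_def)
  from full show ?thesis
  proof
    assume full1: "full 1 \<and> 0 \<le> h 1"
    have "0 \<le> m p \<and> h p \<le> m p" if "p \<in> {1..k}" for p
    proof -
      have "p = 1 \<or> p = 2 \<or> 3 \<le> p" using that by auto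
      then consider "p = 1" | "p = 2" | "3 \<le> p" by blast
      then show ?thesis using large[of p] that w12 w3 full1 by cases auto
    qed
    moreover have "m (Suc p) \<le> m p" if "p \<in> {1..<k}" "\<exists>i\<in>{1..p}. \<not> full i" for p
    proof -
      have "p \<noteq> 1" using that full1 by auto
      then have "p = 2 \<or> 3 \<le> p" using that(1) by auto
      then consider "p = 2" | "3 \<le> p" by blast
      then show ?thesis using mono[of p] that w12 by cases (auto simp: numeral_3_eq_3)
    qed
    ultimately have "witness full h m" by (simp add: witness_def)
    then show thesis using that by simp
  next
    assume full3: "full 3 \<and> h 2 \<le> h 3"
    \<comment> \<open>The excess of \<open>m 2\<close> over \<open>m 3\<close> moves to index 1.
      Then \<open>2 * m 3 - h 1 \<le> m 2\<close> is the monotonicity at index 1, and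
      \<open>h 2 \<le> h 3\<close> makes \<open>m 3\<close> large enough at index 2.\<close>
    define m' where "m' = (\<lambda>p. m p + (m 2 - m 3) * (step_at 1 p - 2 * step_at 2 p + step_at 3 p))"
    have m': "m' 1 = m 1 + m 2 - m 3" "m' 2 = m 3" "\<And>p. 3 \<le> p \<Longrightarrow> m' p = m p"
      by (auto simp: m'_def step_at_def)
    have "0 \<le> m' p \<and> h p \<le> m' p" if "p \<in> {1..k}" for p
    proof -
      have "p = 1 \<or> p = 2 \<or> 3 \<le> p" using that by auto
      then consider "p = 1" | "p = 2" | "3 \<le> p" by blast
      then show ?thesis using large[of p] that w12 w3 full3 m' by cases auto
    qed
    moreover have "m' (Suc p) \<le> m' p" if "p \<in> {1..<k}" for p
    proof -
      have "p = 1 \<or> p = 2 \<or> 3 \<le> p" using that by auto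
      then consider "p = 1" | "p = 2" | "3 \<le> p" by blast
      then show ?thesis using mono[of p] that w12 m'
        by cases (auto simp: numeral_3_eq_3 numeral_2_eq_2)
    qed
    ultimately have "witness full h m'" by (simp add: witness_def)
    moreover have "pot h m' = pot h m"
      using k s_1 s_2 s_3 by (simp add: pot_def m'_def gap_sum_simps)
    ultimately show thesis using that by simp
  qed
qed

text \<open>The flag \<open>tie\<close> records that \<open>k \<ge> 3\<close> and \<open>{0, 2, 4}\<close> is cut at \<open>{0}\<close>.\<close>

definition tie_pick :: "bool \<Rightarrow> nat set \<Rightarrow> nat \<Rightarrow> nat \<Rightarrow> bool" where
  "tie_pick tie F j a \<longleftrightarrow>
     (if tie \<and> 1 \<in> F \<and> 3 \<in> F \<and> j = 2 then a = (if 2 \<in> F then 2 else 3) else pick F j a)"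

text \<open>The cut points of the recursion. Cutting off the last of \<open>j + 1\<close> servers
  gives \<open>x = 1\<close> for \<open>j = 1\<close> and \<open>x = s j / 3\<close> otherwise. If
  \<open>{0, 2, 4}\<close> is cut at \<open>{0}\<close>, then \<open>x = 4 / 3\<close>, and
  \<open>{2, 4}\<close> is afterwards cut at its midpoint 3.\<close>

definition threshold :: "bool \<Rightarrow> nat \<Rightarrow> real" where
  "threshold tie j = (if j = 1 then if tie then 4 / 3 else 1 else if j = 2 \<and> tie then 3 else 4 / 3 * s j)"

definition home :: "bool \<Rightarrow> nat \<Rightarrow> real \<Rightarrow> nat \<Rightarrow> bool" where
  "home tie n r j \<longleftrightarrow> j \<in> {1..n} \<and> (j = 1 \<or> threshold tie (j - 1) < r) \<and> (j = n \<or> r \<le> threshold tie j)"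

definition phase_witness :: "bool \<Rightarrow> (nat \<Rightarrow> bool) \<Rightarrow> (nat \<Rightarrow> int) \<Rightarrow> (nat \<Rightarrow> int) \<Rightarrow> bool" where
  "phase_witness tie full h m \<longleftrightarrow> (if tie \<and> \<not> full 1 \<and> \<not> full 3 then tie_witness h m else witness full h m)"

section \<open>The home compared with the server of the optimum\<close>

lemma home_lower:
  assumes "home tie k r j" "q < j" "q \<in> {1..k}"
  shows "(if j = 2 then (if tie then 4/3 else 1) < r else if j = 3 \<and> tie then 3 < r else 2 * s j < 3 * r)
    \<and> 2 * s q \<le> s j"
proof -
  have j: "2 \<le> j" "j \<le> k" and r: "threshold tie (j - 1) < r" using assms by (auto simp: home_def)
  have "s j = 2 * s (j - 1)" if "j \<noteq> 2" using s_Suc[of "j - 1"] j that by simp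
  moreover have "j - 1 \<noteq> 1" if "j \<noteq> 2" using that j by simp
  moreover have "j - 1 = 2 \<longleftrightarrow> j = 3" using j by auto
  ultimately show ?thesis using r double_s_le[of q j] assms j by (auto simp: threshold_def split: if_splits)
qed

lemma home_upper:
  assumes "home tie k r j" "j < q" "q \<in> {1..k}"
  shows "(if j = 1 then r \<le> (if tie then 4/3 else 1) else if j = 2 \<and> tie then r \<le> 3 else 3 * r \<le> 4 * s j)
    \<and> 2 * s j \<le> s q \<and> 2 \<le> s q"
  using assms double_s_le[of j q] s_le[of 2 q] s_2 by (auto simp: home_def threshold_def split: if_splits)

text \<open>The source of the constant 5: for \<open>q = j + 1\<close> and \<open>r\<close> at the
  cut point \<open>4 / 3 * s j\<close>, with \<open>2 \<le> j\<close>, both sides agree. The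
  excluded case really fails: for \<open>r = 3\<close> the left side is 7 and the right side is
  5.\<close>

lemma home_dist:
  assumes home: "home tie k r j" and q: "q \<in> {1..k}" and exc: "\<not> (tie \<and> j = 2 \<and> q = 3)"
    and k: "tie \<Longrightarrow> 3 \<le> k"
  shows "\<bar>r - s j\<bar> + (if q \<le> j then s j - s q else s j + s q) \<le> 5 * \<bar>r - s q\<bar>"
proof -
  have j: "j \<in> {1..k}" using home by (simp add: home_def)
  have nn: "0 \<le> s j" "0 \<le> s q" using s_nonneg j q by auto
  consider "q = j" | "q < j" | "j < q" by linarith
  then show ?thesis
  proof cases
    case 2
    have q1: "s q = 0" if "j = 2"
      using that 2 q s_1 by (cases "q = 1") auto
    have s2: "s j = 2" if "j = 2" using that j s_2 by simp
    have s3: "s j = 4" if "j = 3" using that j s_3 by simp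
    \<comment> \<open>The second inequality settles the case \<open>s j \<le> r\<close>, the third
      the case \<open>r < s j\<close>.\<close>
    have b: "2 * s q \<le> s j" "s q < r" "4 * s q + 2 * s j \<le> 6 * r"
      using home_lower[OF home 2 q] q1 s2 s3 nn by (auto split: if_splits)
    have "\<bar>r - s j\<bar> + s j - s q \<le> 5 * (r - s q)"
      using b by (simp add: abs_if)
    then show ?thesis using 2 b by simp
  next
    case 3
    have s1: "s j = 0" if "j = 1" using that s_1 by simp
    have s2: "s j = 2" if "j = 2" using that j s_2 by simp
    have q4: "8 \<le> s q" if "j = 2" tie using s_ge_8[of q] that q 3 exc by auto
    have b: "2 * s j \<le> s q" "r < s q" "6 * r \<le> 4 * s q" "4 * r + 2 * s j \<le> 4 * s q"
      using home_upper[OF home 3 q] s1 s2 q4 nn by (auto split: if_splits)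
    have "\<bar>r - s j\<bar> + s j + s q \<le> 5 * (s q - r)"
      using b by (simp add: abs_if)
    then show ?thesis using 3 b by simp
  qed simp
qed

text \<open>The cut points 4/3 and 3 confine \<open>r\<close> enough to pay for the longer detours
  from home 2. The case \<open>q = 1\<close> becomes an equality as \<open>r\<close> approaches
  4/3.\<close>

lemma home_tie_dist:
  assumes home: "home True k r j" and q: "q \<in> {1..k}" and k: "3 \<le> k"
  shows "\<bar>r - s j\<bar> + tie_dist j q \<le> 5 * \<bar>r - s q\<bar>"
proof (cases "j = 2 \<and> q \<noteq> 2")
  case True
  then consider "q = 1" | "q = 3" | "4 \<le> q" using q by fastforce
  then show ?thesis
  proof cases
    case 1
    then show ?thesis using True home_lower[OF home, of q] q k s_1 s_2
      by (simp add: tie_dist_def)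
  next
    case 2
    then show ?thesis using True home_upper[OF home, of q] q k s_3 s_2
      by (simp add: tie_dist_def)
  next
    case 3
    then show ?thesis using True home_upper[OF home, of q] q k s_2 s_ge_8[of q]
      by (simp add: tie_dist_def)
  qed
next
  case False
  then show ?thesis using home_dist[OF home q] k by (auto simp: tie_dist_def)
qed

text \<open>Once one of the servers 0 and 4 is full, home 2 against the optimum's 4 no longer
  costs a detour via 0: either 0 is full, or the optimum was behind at 4.\<close>

lemma witness_virtual_2_3:
  assumes k: "3 \<le> k" and w: "witness full h m" and full: "full 1 \<or> full 3 \<and> h 2 < h 3"
  obtains m' where "witness full (\<lambda>p. h p + step_at 2 p - step_at 3 p) m'"
    "pot (\<lambda>p. h p + step_at 2 p - step_at 3 p) m' \<le> pot h m + 2"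
proof -
  let ?h = "\<lambda>p. h p + step_at 2 p - step_at 3 p"
  have h: "?h 2 = h 2 + 1" "p \<noteq> 2 \<Longrightarrow> ?h p = h p" for p by (auto simp: step_at_def)
  have w1: "0 \<le> m p \<and> h p \<le> m p" if "p \<in> {1..k}" for p using w that by (simp add: witness_def)
  have w2: "m (Suc p) \<le> m p" if "p \<in> {1..<k}" "\<exists>i\<in>{1..p}. \<not> full i" for p
    using w that unfolding witness_def by blast
  show thesis
  proof (cases "full 1")
    case True
    let ?m = "\<lambda>p. m p + (step_at 2 p - step_at 3 p)"
    have m: "?m 2 = m 2 + 1" "p \<noteq> 2 \<Longrightarrow> ?m p = m p" for p by (auto simp: step_at_def)
    have "0 \<le> ?m p \<and> ?h p \<le> ?m p" if "p \<in> {1..k}" for p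
      using w1[of p] that by (auto simp: step_at_def)
    moreover have "?m (Suc p) \<le> ?m p" if p: "p \<in> {1..<k}" "\<exists>i\<in>{1..p}. \<not> full i" for p
    proof -
      have "p \<noteq> 1" using p(2) True by auto
      then have "2 \<le> p" using p by auto
      then show ?thesis using w2[OF p] by (auto simp: step_at_def)
    qed
    ultimately have "witness full ?h ?m" by (simp add: witness_def)
    moreover have "pot ?h ?m = pot h m + 2"
      using k s_2 s_3 by (simp add: pot_def gap_sum_simps)
    ultimately show thesis using that by simp
  next
    case False
    then have h23: "h 2 < h 3" and nf: "\<exists>i\<in>{1..2}. \<not> full i" using full by auto
    have "h 2 < m 2" using h23 w1[of 3] w2[OF _ nf] k by (simp add: numeral_3_eq_3)
    then have "?h p \<le> m p" if "p \<in> {1..k}" for p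
      using w1[of p] that h by (cases "p = 2") auto
    then have "witness full ?h m" using w by (simp add: witness_def)
    moreover have "pot ?h m = pot h m - 2"
      using k s_2 s_3 by (simp add: pot_def gap_sum_simps)
    ultimately show thesis using that by simp
  qed
qed

section \<open>The amortized inequality for one request\<close>

lemma surplus_23:
  assumes "y 3 \<le> x 3"
  shows "surplus x y 2 \<le> surplus x y 3"
proof (rule surplus_le)
  fix i :: nat assume "i \<in> {2<..3}"
  then have "i = 3" by auto
  then show "y i \<le> x i" using assms by simp
qed simp

lemma surplus_23_less:
  assumes "y 3 < x 3"
  shows "surplus x y 2 < surplus x y 3"
proof (rule surplus_less[of 2 3 _ _ 3])
  fix i :: nat assume "i \<in> {2<..3}"
  then have "i = 3" by auto
  then show "y i \<le> x i" using assms by simp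
qed (use assms in auto)

text \<open>Booking at the home, then carrying to \<open>a\<close>, then possibly changing the
  phase; the triangle inequality joins the distances of the first two.\<close>

lemma phase_witness_step:
  assumes k: "tie \<Longrightarrow> 3 \<le> k" and w: "phase_witness tie (\<lambda>i. c i \<le> x i) (surplus x y) m"
    and x: "\<And>i. i \<in> {1..k} \<Longrightarrow> x i \<le> c i"
    and y: "\<And>i. i \<in> {1..k} \<Longrightarrow> (y(q := Suc (y q))) i \<le> c i"
    and q: "q \<in> {1..k}" and home: "home tie k r j"
    and pick: "tie_pick tie {i \<in> {1..k}. x i < c i} j a"
  obtains m' where "phase_witness tie (\<lambda>i. c i \<le> (x(a := Suc (x a))) i) (surplus (x(a := Suc (x a))) (y(q := Suc (y q)))) m'"
    "\<bar>r - s a\<bar> + pot (surplus (x(a := Suc (x a))) (y(q := Suc (y q)))) m' \<le>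
     pot (surplus x y) m + 5 * \<bar>r - s q\<bar>"
proof -
  define h where "h = surplus x y"
  define y' where "y' = y(q := Suc (y q))"
  define hv where "hv = surplus (x(j := Suc (x j))) y'"
  define x' where "x' = x(a := Suc (x a))"
  define full where "full = (\<lambda>i. c i \<le> x i)"
  define full' where "full' = (\<lambda>i. c i \<le> x' i)"
  have j: "j \<in> {1..k}" using home by (simp add: home_def)
  have y': "\<And>i. i \<in> {1..k} \<Longrightarrow> y' i \<le> c i" using y by (simp add: y'_def)
  have hv: "hv = (\<lambda>p. h p + step_at j p - step_at q p)"
    using j q by (auto simp: hv_def h_def y'_def surplus_left_Suc surplus_right_Suc)
  have tri: "\<bar>r - s a\<bar> \<le> \<bar>r - s j\<bar> + \<bar>s a - s j\<bar>" by linarith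
  note result = that
  have concl: thesis if "phase_witness tie full' (surplus x' y') m'"
      "\<bar>r - s a\<bar> + pot (surplus x' y') m' \<le> pot h m + 5 * \<bar>r - s q\<bar>" for m'
    using result[of m'] that unfolding full'_def x'_def y'_def h_def by blast
  show thesis
  proof (cases "tie \<and> \<not> full 1 \<and> \<not> full 3")
    case True
    then have k3: "3 \<le> k" and free: "x 1 < c 1" "x 3 < c 3" using k by (auto simp: full_def)
    have "tie_witness h m" using w True by (simp add: phase_witness_def full_def h_def)
    then obtain mv where mv: "tie_witness hv mv" "pot hv mv \<le> pot h m + tie_dist j q"
      using tie_witness_virtual[OF k3 _ j q] unfolding hv by blast
    have "if j = 2 then a = (if x 2 < c 2 then 2 else 3) else pick {i \<in> {1..k}. x i < c i} j a"
      using pick True free k3 by (simp add: tie_pick_def)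
    then obtain m1 where m1: "tie_witness (surplus x' y') m1"
        "pot (surplus x' y') m1 + \<bar>s a - s j\<bar> \<le> pot hv mv"
      using tie_witness_move[OF k3 mv(1)[unfolded hv_def] x y' free _ j] unfolding hv_def x'_def by blast
    have "\<bar>r - s j\<bar> + tie_dist j q \<le> 5 * \<bar>r - s q\<bar>"
      using home_tie_dist[OF _ q k3] home True by simp
    then have bound: "\<bar>r - s a\<bar> + pot (surplus x' y') m1 \<le> pot h m + 5 * \<bar>r - s q\<bar>"
      using mv m1 tri by linarith
    show thesis
    proof (cases "full' 1 \<or> full' 3")
      case False
      then show thesis using concl[of m1] m1 bound True by (simp add: phase_witness_def)
    next
      case True
      \<comment> \<open>The optimum respects the capacities, so a server that is full for PTCP
        contributes a nonnegative difference. This yields the side condition for the change of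
        phase.\<close>
      have "0 \<le> surplus x' y' 1" if "full' 1"
        using that y'[of 1] k3 by (simp add: full'_def surplus_def)
      moreover have "surplus x' y' 2 \<le> surplus x' y' 3" if "full' 3"
        using surplus_23[of y' x'] that y'[of 3] k3 by (simp add: full'_def)
      ultimately obtain m2 where "witness full' (surplus x' y') m2"
          "pot (surplus x' y') m2 \<le> pot (surplus x' y') m1"
        using tie_witness_imp_witness[OF k3 m1(1), of full'] True by blast
      moreover from this have "phase_witness tie full' (surplus x' y') m2" using True by (auto simp: phase_witness_def)
      ultimately show thesis using concl[of m2] bound by linarith
    qed
  next
    case False
    have wh: "witness full h m" using w False by (simp add: phase_witness_def full_def h_def)
    \<comment> \<open>The case excluded from \<open>home_dist\<close> uses the shorter increase 2
      instead. If 4 is full for PTCP, the optimum still has room there for the present request,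
      whence \<open>h 2 < h 3\<close>.\<close>
    have "\<exists>mv. witness full hv mv \<and> \<bar>r - s j\<bar> + pot hv mv \<le> pot h m + 5 * \<bar>r - s q\<bar>"
    proof (cases "tie \<and> j = 2 \<and> q = 3")
      case True
      then have k3: "3 \<le> k" using k by simp
      have "full 1 \<or> full 3" using False True by simp
      moreover have "h 2 < h 3" if "full 3"
        unfolding h_def using surplus_23_less[of y x] that y[of 3] True k3 by (simp add: full_def)
      ultimately obtain mv where mv: "witness full hv mv" "pot hv mv \<le> pot h m + 2"
        using witness_virtual_2_3[OF k3 wh] True unfolding hv by blast
      have "r \<le> 3" using home True k3 by (simp add: home_def threshold_def)
      then have "\<bar>r - s j\<bar> + 2 \<le> 5 * \<bar>r - s q\<bar>" using True k3 s_2 s_3 by simp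
      then show ?thesis using mv by (intro exI[of _ mv]) linarith
    next
      case False
      obtain mv where "witness full hv mv"
        "pot hv mv \<le> pot h m + (if q \<le> j then s j - s q else s j + s q)"
        using witness_virtual[OF wh j q] unfolding hv by blast
      then show ?thesis using home_dist[OF home q False k] by (intro exI[of _ mv]) linarith
    qed
    then obtain mv where mv: "witness full hv mv" "\<bar>r - s j\<bar> + pot hv mv \<le> pot h m + 5 * \<bar>r - s q\<bar>"
      by blast
    have "pick {i \<in> {1..k}. x i < c i} j a"
      using pick False by (auto simp: tie_pick_def full_def split: if_splits)
    then obtain m1 where m1: "witness full' (surplus x' y') m1"
        "pot (surplus x' y') m1 + \<bar>s a - s j\<bar> \<le> pot hv mv"
      using witness_move[OF mv(1)[unfolded hv_def full_def] x y' _ j]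
      unfolding hv_def full'_def x'_def by blast
    \<comment> \<open>Full servers stay full, so the tie phase never returns.\<close>
    have "full' i" if "full i" for i using that by (auto simp: full_def full'_def x'_def)
    then have "phase_witness tie full' (surplus x' y') m1"
      using m1 False by (auto simp: phase_witness_def)
    then show thesis using concl[of m1] m1 mv tri by linarith
  qed
qed

text \<open>In the tie phase \<open>m 1 = h 1\<close> may be negative. Exchanging
  \<open>min (h 1) 0\<close> between the first two gaps, of equal length, repairs this at no cost,
  and declaring every server full removes the monotonicity condition.\<close>

lemma phase_witness_pot_nonneg:
  assumes "phase_witness tie full h m" "tie \<Longrightarrow> 3 \<le> k"
  shows "0 \<le> pot h m"
proof (cases "tie \<and> \<not> full 1 \<and> \<not> full 3")
  case False
  then show ?thesis using assms pot_nonneg[of full h m] by (auto simp: phase_witness_def)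
next
  case True
  then have k: "3 \<le> k" and w: "tie_witness h m" using assms by (auto simp: phase_witness_def)
  define d where "d = min (h 1) 0"
  define m' where "m' = (\<lambda>p. m p - d * (step_at 1 p - 2 * step_at 2 p + step_at 3 p))"
  have m': "m' 1 = m 1 - d" "m' 2 = m 2 + d" "\<And>p. 3 \<le> p \<Longrightarrow> m' p = m p"
    by (auto simp: m'_def step_at_def)
  have m3: "0 \<le> m 3" using w k by (simp add: tie_witness_def)
  have "0 \<le> m' p \<and> h p \<le> m' p" if "p \<in> {1..k}" for p
  proof -
    have "p = 1 \<or> p = 2 \<or> 3 \<le> p" using that by auto
    then consider "p = 1" | "p = 2" | "3 \<le> p" by blast
    then show ?thesis using w that m3 m' unfolding d_def tie_witness_def by cases auto
  qed
  then have "witness (\<lambda>_. True) h m'" by (simp add: witness_def)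
  moreover have "pot h m' = pot h m"
    using k s_1 s_2 s_3 by (simp add: pot_def m'_def gap_sum_simps)
  ultimately show ?thesis using pot_nonneg by metis
qed

section \<open>From one request to whole sequences\<close>

definition load_at :: "matching \<Rightarrow> nat \<Rightarrow> nat" where
  "load_at M i = (if i \<in> {1..k} then load M (s i) else 0)"

text \<open>An equation of functions: the value 0 outside \<open>{1..k}\<close> matters, since
  \<open>s\<close> is arbitrary there and could repeat a server position.\<close>

lemma load_at_append:
  assumes "a \<in> {1..k}"
  shows "load_at (M @ [(r, s a)]) = (load_at M)(a := Suc (load_at M a))"
proof
  fix i
  have "s a = s i \<longleftrightarrow> a = i" if "i \<in> {1..k}"
    using that assms inj_s by (auto dest: inj_onD)
  then show "load_at (M @ [(r, s a)]) i = ((load_at M)(a := Suc (load_at M a))) i"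
    using assms by (auto simp: load_at_def load_append)
qed

definition follows :: "bool \<Rightarrow> nat \<Rightarrow> real set \<Rightarrow> real \<Rightarrow> real \<Rightarrow> bool" where
  "follows tie n F r v \<longleftrightarrow> (\<exists>j a. home tie n r j \<and> tie_pick tie {i \<in> {1..n}. s i \<in> F} j a \<and> v = s a)"

text \<open>\<open>N\<close> is the part of the comparison matching already consumed and
  \<open>N'\<close> the rest. Capacities are demanded of \<open>N @ N'\<close> only; the bounds for
  prefixes follow as loads only grow.\<close>

lemma serve_le:
  assumes k: "tie \<Longrightarrow> 3 \<le> k" and S: "S = s ` {1..k}"
    and A: "\<And>M r. free S c M \<noteq> {} \<Longrightarrow> follows tie k (free S c M) r (A M r)"
    and "snd ` set M \<subseteq> S" "\<And>v. v \<in> S \<Longrightarrow> load M v \<le> c v"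
    and "length M + length \<sigma> \<le> (\<Sum>v\<in>S. c v)"
    and "map fst N' = \<sigma>" "snd ` set N' \<subseteq> S" "\<And>v. v \<in> S \<Longrightarrow> load (N @ N') v \<le> c v"
    and "phase_witness tie (\<lambda>i. c (s i) \<le> load_at M i) (surplus (load_at M) (load_at N)) m"
    and "match_cost M + pot (surplus (load_at M) (load_at N)) m \<le> 5 * match_cost N"
  shows "match_cost (serve A M \<sigma>) \<le> 5 * match_cost (N @ N')"
  using assms(4-)
proof (induction \<sigma> arbitrary: M N N' m)
  case Nil
  then show ?case using phase_witness_pot_nonneg[OF Nil.prems(7) k] by (simp add: match_cost_append match_cost_Nil)
next
  case (Cons r \<sigma>)
  note prems = Cons.prems
  obtain v N'' where N': "N' = (r, v) # N''" "map fst N'' = \<sigma>" using prems(4) by auto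
  then obtain q where q: "q \<in> {1..k}" "v = s q" using prems(5) S by auto
  have "finite S" using S by simp
  then have "free S c M \<noteq> {}" using prems by (intro free_nonempty) auto
  then obtain j a where ja: "home tie k r j" "tie_pick tie {i \<in> {1..k}. s i \<in> free S c M} j a" "A M r = s a"
    using A unfolding follows_def by blast
  have free: "{i \<in> {1..k}. s i \<in> free S c M} = {i \<in> {1..k}. load_at M i < c (s i)}"
    using S by (auto simp: free_def load_at_def)
  have a: "a \<in> {1..k}" "load_at M a < c (s a)"
    using ja(2) k unfolding free tie_pick_def pick_def by (auto split: if_splits)
  let ?x = "load_at M" and ?y = "load_at N"
  have x: "?x i \<le> c (s i)" if "i \<in> {1..k}" for i
    using prems(2)[of "s i"] that S by (auto simp: load_at_def)
  have y: "(?y(q := Suc (?y q))) i \<le> c (s i)" if i: "i \<in> {1..k}" for i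
  proof -
    have "load (N @ [(r, s q)]) (s i) \<le> load ((N @ [(r, s q)]) @ N'') (s i)"
      by (rule load_append_mono)
    also have "\<dots> \<le> c (s i)" using prems(6)[of "s i"] i S N' q by simp
    finally show ?thesis using i unfolding load_at_append[OF q(1), of N r, symmetric] by (simp add: load_at_def)
  qed
  obtain m' where m': "phase_witness tie (\<lambda>i. c (s i) \<le> (?x(a := Suc (?x a))) i) (surplus (?x(a := Suc (?x a))) (?y(q := Suc (?y q)))) m'"
    "\<bar>r - s a\<bar> + pot (surplus (?x(a := Suc (?x a))) (?y(q := Suc (?y q)))) m' \<le> pot (surplus ?x ?y) m + 5 * \<bar>r - s q\<bar>"
    using phase_witness_step[OF k prems(7) x y q(1) ja(1) ja(2)[unfolded free]] by blast
  have "match_cost (serve A (M @ [(r, s a)]) \<sigma>) \<le> 5 * match_cost ((N @ [(r, s q)]) @ N'')"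
  proof (rule Cons.IH)
    show "snd ` set (M @ [(r, s a)]) \<subseteq> S" using prems(1) a S by auto
    show "load (M @ [(r, s a)]) v \<le> c v" if "v \<in> S" for v
      using prems(2)[OF that] a by (auto simp: load_append load_at_def)
    show "length (M @ [(r, s a)]) + length \<sigma> \<le> (\<Sum>v\<in>S. c v)" using prems(3) by simp
    show "map fst N'' = \<sigma>" by fact
    show "snd ` set N'' \<subseteq> S" using prems(5) N' by simp
    show "load ((N @ [(r, s q)]) @ N'') v \<le> c v" if "v \<in> S" for v
      using prems(6)[OF that] N' q by simp
    show "phase_witness tie (\<lambda>i. c (s i) \<le> load_at (M @ [(r, s a)]) i)
        (surplus (load_at (M @ [(r, s a)])) (load_at (N @ [(r, s q)]))) m'"
      unfolding load_at_append[OF a(1)] load_at_append[OF q(1)] by (fact m'(1))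
    show "match_cost (M @ [(r, s a)]) + pot (surplus (load_at (M @ [(r, s a)])) (load_at (N @ [(r, s q)]))) m'
        \<le> 5 * match_cost (N @ [(r, s q)])"
      unfolding load_at_append[OF a(1)] load_at_append[OF q(1)] using m'(2) prems(8)
      by (simp add: match_cost_append match_cost_Cons match_cost_Nil)
  qed
  then show ?case using ja(3) N' q by simp
qed

lemma follows_mem:
  assumes "tie \<Longrightarrow> 3 \<le> n" "follows tie n F r v"
  shows "v \<in> F"
  using assms by (auto simp: follows_def tie_pick_def pick_def split: if_splits)

lemma follows_competitive:
  assumes k: "tie \<Longrightarrow> 3 \<le> k" and S: "S = s ` {1..k}"
    and A: "\<And>M r. free S c M \<noteq> {} \<Longrightarrow> follows tie k (free S c M) r (A M r)"
  shows "competitive S c A 5"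
  unfolding competitive_def
proof (intro allI impI)
  fix \<sigma> :: "real list" assume len: "length \<sigma> \<le> (\<Sum>v\<in>S. c v)"
  have fin: "finite S" using S by simp
  have "A M r \<in> free S c M" if "free S c M \<noteq> {}" for M r
    using follows_mem[OF _ A[OF that]] k by blast
  then have "serve A [] \<sigma> \<in> matchings S c \<sigma>"
    using serve_in_matchings[of S c A "[]" \<sigma>] fin len by (simp add: load_def)
  then obtain N where N: "N \<in> matchings S c \<sigma>" "match_cost N = Opt S c \<sigma>"
    using Opt_attained[OF fin, of c \<sigma>] by auto
  have "surplus (load_at []) (load_at []) = (\<lambda>_. 0)"
    by (auto simp: surplus_def)
  then have "match_cost (serve A [] \<sigma>) \<le> 5 * match_cost ([] @ N)"
    using N(1) len
    by (intro serve_le[OF k S A, where m = "\<lambda>_. 0"])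
       (auto simp: matchings_def load_def[of "[]"] phase_witness_def witness_def tie_witness_def pot_def
         gap_sum_def match_cost_Nil)
  then show "alg_cost A \<sigma> \<le> 5 * Opt S c \<sigma>" using N(2) by (simp add: alg_cost_def)
qed

subsection \<open>The recursion of PTCP\<close>

lemma sorted_list_of_servers:
  assumes "1 \<le> lo" "hi \<le> k"
  shows "sorted_list_of_set (s ` {lo..hi}) = map s [lo..<Suc hi]"
proof -
  have "sorted_wrt (<) (map s [lo..<Suc hi])"
    unfolding sorted_wrt_map
    by (rule sorted_wrt_mono_rel[OF _ sorted_wrt_upt]) (use assms s_less in auto)
  then show ?thesis
    using sorted_list_of_set.idem_if_sorted_distinct[of "map s [lo..<Suc hi]"]
    by (simp add: strict_sorted_iff atLeastLessThanSuc_atLeastAtMost del: upt_Suc)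
qed

lemma card_servers:
  assumes "1 \<le> lo" "hi \<le> k"
  shows "card (s ` {lo..hi}) = Suc hi - lo"
  using card_image[OF inj_on_subset[OF inj_s], of "{lo..hi}"] assms by simp

lemma srv_servers:
  assumes "1 \<le> lo" "hi \<le> k" "1 \<le> i" "i \<le> Suc hi - lo"
  shows "srv (s ` {lo..hi}) i = s (lo + i - 1)"
  using assms by (simp add: srv_def sorted_list_of_servers del: upt_Suc)

text \<open>One unfolding on a block of consecutive servers, with the cut point \<open>t\<close>
  simplified. It also holds for a singleton \<open>F\<close>, where the recursion stops at once:
  going on would return the same server.\<close>

lemma ptcp_split:
  assumes lohi: "1 \<le> lo" "lo \<le> b" "b < hi" "hi \<le> k"
    and \<tau>: "\<tau> (s ` {lo..hi}) \<in> max_gaps (s ` {lo..hi})" "\<tau> (s ` {lo..hi}) = b - lo + 1"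
    and F: "F \<subseteq> s ` {lo..hi}" "F \<noteq> {}"
    and L: "L = s ` {lo..b}" and R: "R = s ` {Suc b..hi}"
    and t: "t = s b + (s hi - s b) / (s hi - s lo + (s (Suc b) - s b)) * (s (Suc b) - s b)"
  shows "ptcp \<tau> (s ` {lo..hi}) r F =
    (if r \<le> t \<and> F \<inter> L \<noteq> {} \<or> F \<inter> R = {} then ptcp \<tau> L r (F \<inter> L) else ptcp \<tau> R r (F \<inter> R))"
proof -
  have S: "s ` {lo..hi} = L \<union> R"
    using lohi by (auto simp: L R image_Un[symmetric] intro!: arg_cong[of _ _ "image s"])
  have LR: "L \<inter> R = {}"
  proof -
    have "s i \<noteq> s i'" if "i \<in> {lo..b}" "i' \<in> {Suc b..hi}" for i i'
      using s_less[of i i'] that lohi by simp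
    then show ?thesis unfolding L R by blast
  qed
  show ?thesis
  proof (cases "is_singleton F")
    case True
    then obtain v where v: "F = {v}" by (auto simp: is_singleton_def)
    have single: "ptcp \<tau> T r {v} = v" for T by (subst ptcp.simps) simp
    show ?thesis using v F S LR by (cases "v \<in> L") (auto simp: single Int_insert_left)
  next
    case False
    let ?S = "s ` {lo..hi}"
    have srv: "srv ?S (\<tau> ?S) = s b" "srv ?S (\<tau> ?S + 1) = s (Suc b)" "srv ?S 1 = s lo" "srv ?S (card ?S) = s hi"
      using lohi by (simp_all add: \<tau>(2) srv_servers card_servers)
    have "s i \<le> s b \<longleftrightarrow> i \<le> b" "s (Suc b) \<le> s i \<longleftrightarrow> Suc b \<le> i" if "i \<in> {lo..hi}" for i
      using that lohi s_le[of i b] s_less[of b i] s_le[of "Suc b" i] s_less[of i "Suc b"]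
      by (cases "i \<le> b", simp_all)+
    moreover have "{lo..b} \<subseteq> {lo..hi}" "{Suc b..hi} \<subseteq> {lo..hi}" using lohi by auto
    ultimately have 1: "{v \<in> ?S. v \<le> s b} = L" "{v \<in> ?S. s (Suc b) \<le> v} = R"
      unfolding L R by (auto simp: image_iff)
    have 2: "s hi - s (Suc b) + (s (Suc b) - s b) = s hi - s b"
      "s b - s lo + (s hi - s (Suc b)) + 2 * (s (Suc b) - s b) = s hi - s lo + (s (Suc b) - s b)"
      by simp_all
    show ?thesis
      by (subst ptcp.simps) (simp only: Let_def srv 1 2 t False \<tau>(1) if_False not_True_eq_False)
  qed
qed

text \<open>From four servers on, the last gap \<open>s n\<close> exceeds all others by doubling.
  Only \<open>{0, 2, 4}\<close> has two equal gaps.\<close>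

lemma max_gaps_servers:
  assumes "1 \<le> n" "Suc n \<le> k" "n \<noteq> 2" "a \<in> max_gaps (s ` {1..Suc n})"
  shows "a = n"
proof (rule ccontr)
  assume "a \<noteq> n"
  then have a: "1 \<le> a" "a < n" and le: "\<forall>u. 1 \<le> u \<and> u < Suc n \<longrightarrow>
      srv (s ` {1..Suc n}) (u + 1) - srv (s ` {1..Suc n}) u \<le> srv (s ` {1..Suc n}) (a + 1) - srv (s ` {1..Suc n}) a"
    using assms by (auto simp: max_gaps_def card_servers)
  have n: "3 \<le> n" using a assms by simp
  have "srv (s ` {1..Suc n}) (n + 1) - srv (s ` {1..Suc n}) n \<le> srv (s ` {1..Suc n}) (a + 1) - srv (s ` {1..Suc n}) a"
    using le assms(1) by simp
  then have "s (Suc n) - s n \<le> s (Suc a) - s a"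
    using a assms by (simp add: srv_servers)
  moreover have "s (Suc n) = 2 * s n" using n assms s_Suc[of n] by simp
  moreover have "s (Suc a) - s a < s n"
  proof (cases "a = 1")
    case True
    then show ?thesis using s_1 s_2 s_3 s_le[of 3 n] n assms by (simp add: numeral_2_eq_2)
  next
    case False
    then show ?thesis using s_Suc[of a] s_less[of a n] a assms by simp
  qed
  ultimately show False by linarith
qed

lemma ptcp_Suc:
  assumes n: "1 \<le> n" "Suc n \<le> k"
    and \<tau>: "\<tau> (s ` {1..Suc n}) \<in> max_gaps (s ` {1..Suc n})" "\<tau> (s ` {1..Suc n}) = n"
    and F: "F \<subseteq> s ` {1..Suc n}" "F \<noteq> {}"
  shows "ptcp \<tau> (s ` {1..Suc n}) r F =
    (if r \<le> threshold False n \<and> F \<inter> s ` {1..n} \<noteq> {} \<or> s (Suc n) \<notin> F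
     then ptcp \<tau> (s ` {1..n}) r (F \<inter> s ` {1..n}) else s (Suc n))"
proof -
  have "threshold False n = s n + (s (Suc n) - s n) / (s (Suc n) - s 1 + (s (Suc n) - s n)) * (s (Suc n) - s n)"
  proof (cases "n = 1")
    case True
    then show ?thesis using s_1 s_2 n by (simp add: threshold_def numeral_2_eq_2)
  next
    case False
    then have "s (Suc n) = 2 * s n" "0 < s n" using n s_Suc[of n] s_less[of 1 n] s_1 by auto
    then show ?thesis using False s_1 by (simp add: threshold_def field_simps)
  qed
  from ptcp_split[of 1 n "Suc n" \<tau> F _ _ _ r, OF order_refl _ _ _ \<tau>(1) _ F refl refl this]
  have split: "ptcp \<tau> (s ` {1..Suc n}) r F =
    (if r \<le> threshold False n \<and> F \<inter> s ` {1..n} \<noteq> {} \<or> F \<inter> s ` {Suc n..Suc n} = {}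
     then ptcp \<tau> (s ` {1..n}) r (F \<inter> s ` {1..n})
     else ptcp \<tau> (s ` {Suc n..Suc n}) r (F \<inter> s ` {Suc n..Suc n}))"
    using n \<tau>(2) by simp
  show ?thesis
  proof (cases "s (Suc n) \<in> F")
    case True
    then have "F \<inter> s ` {Suc n..Suc n} = {s (Suc n)}" by auto
    then show ?thesis unfolding split using True by (auto simp: ptcp.simps[of _ _ _ "{s (Suc n)}"])
  next
    case False
    then have "F \<inter> s ` {Suc n..Suc n} = {}" by auto
    then show ?thesis unfolding split using False by simp
  qed
qed

lemma threshold_mono:
  assumes "tie \<Longrightarrow> 3 \<le> k" "1 \<le> i" "i < j" "j < k"
  shows "threshold tie i \<le> threshold tie j"
proof -
  have "2 * s i \<le> s j" "0 \<le> s i" "2 \<le> s j" "3 \<le> j \<Longrightarrow> 4 \<le> s j"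
    using assms double_s_le[of i j] s_nonneg[of i] s_le[of 2 j] s_le[of 3 j] s_2 s_3 by auto
  then show ?thesis using assms by (auto simp: threshold_def)
qed

lemma home_exists:
  assumes "1 \<le> n"
  shows "\<exists>j. home tie n r j"
  using assms
proof (induction n rule: nat_induct_at_least)
  case base
  then show ?case by (intro exI[of _ 1]) (simp add: home_def)
next
  case (Suc n)
  then obtain j where j: "home tie n r j" by blast
  show ?case
  proof (cases "r \<le> threshold tie n")
    case True
    then show ?thesis using j by (intro exI[of _ j]) (auto simp: home_def)
  next
    case False
    then show ?thesis by (intro exI[of _ "Suc n"]) (auto simp: home_def)
  qed
qed

text \<open>The rule survives appending a server on the right. If \<open>r\<close> lies left of the
  new cut, its home is unchanged; otherwise the new server is its home, and if that is full, the
  search to the left continues as from home \<open>n\<close>.\<close>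

lemma follows_extend:
  assumes tie: "tie \<Longrightarrow> 3 \<le> n" and n: "1 \<le> n" "Suc n \<le> k"
    and F: "F \<subseteq> s ` {1..Suc n}" "F \<noteq> {}"
    and left: "F \<inter> s ` {1..n} \<noteq> {} \<Longrightarrow> follows tie n (F \<inter> s ` {1..n}) r v"
    and w: "w = (if r \<le> threshold False n \<and> F \<inter> s ` {1..n} \<noteq> {} \<or> s (Suc n) \<notin> F then v else s (Suc n))"
  shows "follows tie (Suc n) F r w"
proof -
  \<comment> \<open>The ambiguous cut alters only the first two thresholds.\<close>
  have threshold: "threshold False n = threshold tie n" using tie n by (cases tie) (auto simp: threshold_def)
  define I where "I = {i \<in> {1..Suc n}. s i \<in> F}"
  have I': "{i \<in> {1..n}. s i \<in> F \<inter> s ` {1..n}} = I \<inter> {1..n}" by (auto simp: I_def)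
  have Sn: "Suc n \<in> I \<longleftrightarrow> s (Suc n) \<in> F" by (simp add: I_def)
  have sub: "I \<subseteq> {1..Suc n}" by (auto simp: I_def)
  have empty: "F \<inter> s ` {1..n} = {} \<longleftrightarrow> I \<inter> {1..n} = {}" by (auto simp: I_def)
  have "I \<noteq> {}" using F by (auto simp: I_def)
  have "\<exists>j a. home tie (Suc n) r j \<and> tie_pick tie I j a \<and> w = s a"
  proof (cases "I \<inter> {1..n} \<noteq> {} \<and> (r \<le> threshold tie n \<or> Suc n \<notin> I)")
    case True
    then have "w = v" using w Sn empty threshold by auto
    obtain j a where ja: "home tie n r j" "tie_pick tie (I \<inter> {1..n}) j a" "v = s a"
      using left True empty I' unfolding follows_def by auto
    show ?thesis
    proof (cases "r \<le> threshold tie n")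
      case True
      have "home tie (Suc n) r j" using ja(1) True by (auto simp: home_def)
      moreover have "tie_pick tie I j a"
      proof -
        have mem: "i \<in> I \<inter> {1..n} \<longleftrightarrow> i \<in> I" if "i \<le> n" for i
          using that sub by auto
        have "j \<le> n" using ja(1) by (simp add: home_def)
        have "pick I j a" if p: "pick (I \<inter> {1..n}) j a"
        proof -
          have a: "a \<in> I" "a \<le> n" using p by (auto simp: pick_def)
          then have "i \<in> I \<inter> {1..n} \<longleftrightarrow> i \<in> I" if "i < a \<or> i \<le> j" for i
            using mem[of i] that \<open>j \<le> n\<close> by auto
          then show ?thesis using p a unfolding pick_def by blast
        qed
        then show ?thesis using ja(2) tie mem[of 1] mem[of 2] mem[of 3] unfolding tie_pick_def
          by (cases "tie \<and> 1 \<in> I \<and> 3 \<in> I \<and> j = 2") auto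
      qed
      ultimately show ?thesis using ja \<open>w = v\<close> by blast
    next
      case False
      then have S: "Suc n \<notin> I" using True by simp
      \<comment> \<open>Thresholds increase, so a request beyond the last one has the last server of
        the prefix as its home.\<close>
      have "j = n"
      proof (rule ccontr)
        assume "j \<noteq> n"
        then have "1 \<le> j" "j < n" "r \<le> threshold tie j" using ja(1) by (auto simp: home_def)
        then show False using threshold_mono[of tie j n] tie n False by auto
      qed
      have "home tie (Suc n) r (Suc n)" using False by (simp add: home_def)
      moreover have "I \<inter> {1..n} = I" using sub S by (auto simp: le_Suc_eq)
      then have "tie_pick tie I (Suc n) a"
        using ja(2) S tie sub unfolding \<open>j = n\<close> tie_pick_def pick_def
        by (auto split: if_splits simp: le_Suc_eq)
      ultimately show ?thesis using ja \<open>w = v\<close> by blast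
    qed
  next
    case False
    have S: "Suc n \<in> I"
      using False \<open>I \<noteq> {}\<close> sub by (fastforce simp: le_Suc_eq)
    then have "w = s (Suc n)" using w Sn empty threshold False by auto
    show ?thesis
    proof (cases "r \<le> threshold tie n")
      case True
      then have e: "I \<inter> {1..n} = {}" using False by blast
      obtain j where j: "home tie n r j" using home_exists n by blast
      then have "home tie (Suc n) r j" using True by (auto simp: home_def)
      moreover have "tie_pick tie I j (Suc n)"
      proof -
        have "i \<notin> I" if "i < Suc n" for i using that e sub by fastforce
        then show ?thesis using S j n unfolding tie_pick_def pick_def home_def by auto
      qed
      ultimately show ?thesis using \<open>w = s (Suc n)\<close> by blast
    next
      case False
      then have "home tie (Suc n) r (Suc n)" by (simp add: home_def)
      moreover have "tie_pick tie I (Suc n) (Suc n)"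
        using S n tie by (auto simp: tie_pick_def pick_def)
      ultimately show ?thesis using \<open>w = s (Suc n)\<close> by blast
    qed
  qed
  then show ?thesis by (simp add: follows_def I_def)
qed

lemma gap_choice_servers:
  assumes "gap_choice (s ` {1..k}) \<tau>" "1 \<le> lo" "lo < hi" "hi \<le> k"
  shows "\<tau> (s ` {lo..hi}) \<in> max_gaps (s ` {lo..hi})"
proof -
  have "s ` {lo..hi} \<subseteq> s ` {1..k}" using assms by auto
  moreover have "2 \<le> card (s ` {lo..hi})" using assms by (simp add: card_servers)
  ultimately show ?thesis using assms(1) unfolding gap_choice_def by blast
qed

text \<open>The recursion peels off the last server down to a base of \<open>n0\<close> servers:
  three if \<open>{0, 2, 4}\<close> is cut at \<open>{0}\<close>, otherwise one. \<open>two\<close>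
  settles the only ambiguous cut when the induction passes it.\<close>

lemma ptcp_follows_induct:
  assumes \<tau>: "gap_choice (s ` {1..k}) \<tau>" and n: "1 \<le> n0" "n0 \<le> n" "n \<le> k" and tie: "tie \<Longrightarrow> 3 \<le> n0"
    and two: "n0 \<le> 2 \<Longrightarrow> 3 \<le> k \<Longrightarrow> \<tau> (s ` {1..3}) = 2"
    and base: "\<And>F. F \<subseteq> s ` {1..n0} \<Longrightarrow> F \<noteq> {} \<Longrightarrow> follows tie n0 F r (ptcp \<tau> (s ` {1..n0}) r F)"
    and F: "F \<subseteq> s ` {1..n}" "F \<noteq> {}"
  shows "follows tie n F r (ptcp \<tau> (s ` {1..n}) r F)"
  using n(2,3) F
proof (induction n arbitrary: F rule: dec_induct)
  case base
  then show ?case using assms(7) by blast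
next
  case (step n)
  have mg: "\<tau> (s ` {1..Suc n}) \<in> max_gaps (s ` {1..Suc n})"
    using gap_choice_servers[OF \<tau>, of 1 "Suc n"] step n by simp
  have eq: "\<tau> (s ` {1..Suc n}) = n"
  proof (cases "n = 2")
    case True
    then show ?thesis using two step by (simp add: numeral_3_eq_3)
  next
    case False
    then show ?thesis using max_gaps_servers[OF _ _ _ mg] step n by simp
  qed
  show ?case
  proof (rule follows_extend)
    show "follows tie n (F \<inter> s ` {1..n}) r (ptcp \<tau> (s ` {1..n}) r (F \<inter> s ` {1..n}))"
      if "F \<inter> s ` {1..n} \<noteq> {}"
      using step that by (intro step.IH) auto
    show "ptcp \<tau> (s ` {1..Suc n}) r F = (if r \<le> threshold False n \<and> F \<inter> s ` {1..n} \<noteq> {} \<or> s (Suc n) \<notin> F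
     then ptcp \<tau> (s ` {1..n}) r (F \<inter> s ` {1..n}) else s (Suc n))"
      using step n by (intro ptcp_Suc mg eq) auto
  qed (use step n tie in auto)
qed

text \<open>A check over all subsets of \<open>{0, 2, 4}\<close>. The deviation from
  \<open>pick\<close> arises for \<open>F = {0, 4}\<close> and home 2, where the recursion has
  already committed to \<open>{2, 4}\<close>.\<close>

lemma ptcp_follows_tie_3:
  assumes k: "3 \<le> k" and \<tau>: "gap_choice (s ` {1..k}) \<tau>" "\<tau> (s ` {1..3}) = 1"
    and F: "F \<subseteq> s ` {1..3}" "F \<noteq> {}"
  shows "follows True 3 F r (ptcp \<tau> (s ` {1..3}) r F)"
proof -
  have s123: "s 1 = 0" "s 2 = 2" "s 3 = 4" using s_1 s_2 s_3 k by auto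
  have "\<tau> (s ` {2..3}) \<in> max_gaps (s ` {2..3})"
    using gap_choice_servers[OF \<tau>(1), of 2 3] k by simp
  moreover from this have "\<tau> (s ` {2..3}) = 1"
    using k by (auto simp: max_gaps_def card_servers)
  ultimately have R: "ptcp \<tau> (s ` {2..3}) r G =
      (if r \<le> 3 \<and> G \<inter> s ` {2..2} \<noteq> {} \<or> G \<inter> s ` {3..3} = {}
       then ptcp \<tau> (s ` {2..2}) r (G \<inter> s ` {2..2}) else ptcp \<tau> (s ` {3..3}) r (G \<inter> s ` {3..3}))"
    if "G \<subseteq> s ` {2..3}" "G \<noteq> {}" for G
    using ptcp_split[of 2 2 3 \<tau> G _ _ 3 r] that k s123 by (simp add: numeral_3_eq_3[symmetric])
  have L: "ptcp \<tau> (s ` {1..3}) r F =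
      (if r \<le> 4/3 \<and> F \<inter> s ` {1..1} \<noteq> {} \<or> F \<inter> s ` {2..3} = {}
       then ptcp \<tau> (s ` {1..1}) r (F \<inter> s ` {1..1}) else ptcp \<tau> (s ` {2..3}) r (F \<inter> s ` {2..3}))"
    using ptcp_split[of 1 1 3 \<tau> F _ _ "4/3" r] gap_choice_servers[OF \<tau>(1), of 1 3] F k s123 \<tau>(2)
    by (simp add: numeral_2_eq_2[symmetric])
  have "{1..3} = {1,2,3::nat}" "{2..3} = {2,3::nat}" by auto
  then have im: "s ` {1..3} = {0, 2, 4}" "s ` {2..3} = {2, 4}" "s ` {1..1} = {0}"
    "s ` {2..2} = {2}" "s ` {3..3} = {4}"
    using s123 by simp_all
  have single: "ptcp \<tau> T r {v} = v" for T v by (subst ptcp.simps) simp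
  define j :: nat where "j = (if r \<le> 4/3 then 1 else if r \<le> 3 then 2 else 3)"
  have home: "home True 3 r j" by (auto simp: home_def threshold_def j_def)
  have F024: "F \<subseteq> {0, 2, 4}" using F(1) by (simp only: im)
  define I where "I = {i \<in> {1..3}. s i \<in> F}"
  have I: "i \<in> I \<longleftrightarrow> i = 1 \<and> 0 \<in> F \<or> i = 2 \<and> 2 \<in> F \<or> i = 3 \<and> 4 \<in> F" for i
  proof -
    have "i \<in> {1..3} \<longleftrightarrow> i = 1 \<or> i = 2 \<or> i = 3" by auto
    then show ?thesis using s123 by (auto simp: I_def)
  qed
  define a :: nat where "a = (if r \<le> 4/3 \<and> 0 \<in> F \<or> 2 \<notin> F \<and> 4 \<notin> F then 1
    else if r \<le> 3 \<and> 2 \<in> F \<or> 4 \<notin> F then 2 else 3)"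
  have "ptcp \<tau> (s ` {1..3}) r F = s a"
  proof -
    have sa: "s a = (if r \<le> 4/3 \<and> 0 \<in> F \<or> 2 \<notin> F \<and> 4 \<notin> F then 0 else if r \<le> 3 \<and> 2 \<in> F \<or> 4 \<notin> F then 2 else 4)"
      using s123 by (simp add: a_def)
    have "0 \<in> F \<or> 2 \<in> F \<or> 4 \<in> F" using F(2) F024 by auto
    then show ?thesis unfolding im L[unfolded im] sa
      using R[of "F \<inter> s ` {2..3}", unfolded im]
      by (cases "0 \<in> F"; cases "2 \<in> F"; cases "4 \<in> F")
         (auto simp: single Int_insert_right)
  qed
  moreover have "tie_pick True I j a"
    using F(2) F024 unfolding tie_pick_def pick_def I by (auto simp: a_def j_def)
  ultimately show ?thesis using home unfolding follows_def I_def by blast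
qed

lemma ptcp_follows:
  assumes "gap_choice (s ` {1..k}) \<tau>"
  obtains tie where "tie \<Longrightarrow> 3 \<le> k"
    "\<And>F r. F \<subseteq> s ` {1..k} \<Longrightarrow> F \<noteq> {} \<Longrightarrow> follows tie k F r (ptcp \<tau> (s ` {1..k}) r F)"
proof (cases "3 \<le> k \<and> \<tau> (s ` {1..3}) \<noteq> 2")
  case True
  then have "\<tau> (s ` {1..3}) = 1"
    using gap_choice_servers[OF assms, of 1 3] by (auto simp: max_gaps_def card_servers)
  then have base: "follows True 3 F r (ptcp \<tau> (s ` {1..3}) r F)" if "F \<subseteq> s ` {1..3}" "F \<noteq> {}" for F r
    using ptcp_follows_tie_3[OF _ assms _ that] True by blast
  have "follows True k F r (ptcp \<tau> (s ` {1..k}) r F)" if "F \<subseteq> s ` {1..k}" "F \<noteq> {}" for F r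
    by (rule ptcp_follows_induct[OF assms, of 3]) (use True that base in auto)
  then show ?thesis using that[of True] True by blast
next
  case False
  have base: "follows False 1 F r (ptcp \<tau> (s ` {1..1}) r F)" if "F \<subseteq> s ` {1..1}" "F \<noteq> {}" for F r
  proof -
    have F: "F = {s 1}" using that by auto
    then have "ptcp \<tau> (s ` {1..1}) r F = s 1" by (subst ptcp.simps) simp
    moreover have "{i \<in> {1..1}. s i \<in> F} = {1}" using F by auto
    ultimately show ?thesis unfolding follows_def
      by (intro exI[of _ 1]) (simp add: home_def tie_pick_def pick_def)
  qed
  have "follows False k F r (ptcp \<tau> (s ` {1..k}) r F)" if "F \<subseteq> s ` {1..k}" "F \<noteq> {}" for F r
  proof (rule ptcp_follows_induct[OF assms, of 1 k False])
    show "\<tau> (s ` {1..3}) = 2" if "3 \<le> k" using False that by blast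
  qed (use that k_pos base in \<open>simp_all only: order_refl not_False_eq_True\<close>)
  then show ?thesis using that[of False] by blast
qed

theorem ptcp_competitive:
  assumes "S = s ` {1..k}" "gap_choice S \<tau>"
  shows "competitive S c (ptcp_alg \<tau> S c) 5"
proof -
  obtain tie where tie: "tie \<Longrightarrow> 3 \<le> k"
    "\<And>F r. F \<subseteq> S \<Longrightarrow> F \<noteq> {} \<Longrightarrow> follows tie k F r (ptcp \<tau> S r F)"
    using ptcp_follows[of \<tau>] assms by blast
  show ?thesis
  proof (rule follows_competitive[OF tie(1) assms(1)])
    fix M r assume "free S c M \<noteq> {}"
    then show "follows tie k (free S c M) r (ptcp_alg \<tau> S c M r)"
      unfolding ptcp_alg_def by (intro tie(2)) (auto simp: free_def)
  qed
qed

subsection \<open>Lower bound for greedy\<close>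

lemma greedy_nearest:
  assumes "greedy S c G" "v \<in> free S c M" "\<And>u. u \<in> free S c M \<Longrightarrow> u \<noteq> v \<Longrightarrow> \<bar>r - v\<bar> < \<bar>r - u\<bar>"
  shows "G M r = v"
proof -
  have "is_arg_min (\<lambda>s. \<bar>r - s\<bar>) (\<lambda>s. s \<in> free S c M) (G M r)"
    using assms(1,2) unfolding greedy_def by blast
  then show ?thesis using assms(2,3) unfolding is_arg_min_def by blast
qed

lemma serve_append: "serve A M (xs @ ys) = serve A (serve A M xs) ys"
  by (induction xs arbitrary: M) auto

lemma serve_greedy_fill:
  assumes G: "greedy S c G" and "set xs \<subseteq> S" "\<And>v. v \<in> S \<Longrightarrow> load M v + count_list xs v \<le> c v"
  shows "serve G M xs = M @ map (\<lambda>r. (r, r)) xs"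
  using assms(2,3)
proof (induction xs arbitrary: M)
  case (Cons r xs)
  have "r \<in> free S c M" using Cons.prems(1) Cons.prems(2)[of r] by (simp add: free_def)
  then have "G M r = r" by (intro greedy_nearest[OF G]) auto
  moreover have "serve G (M @ [(r, r)]) xs = (M @ [(r, r)]) @ map (\<lambda>r. (r, r)) xs"
  proof (rule Cons.IH)
    show "load (M @ [(r, r)]) v + count_list xs v \<le> c v" if "v \<in> S" for v
      using Cons.prems(2)[OF that] by (simp add: load_append split: if_splits)
  qed (use Cons.prems in simp)
  ultimately show ?case by simp
qed simp

lemma exists_list_count:
  assumes "finite S"
  shows "\<exists>xs. set xs \<subseteq> S \<and> (\<forall>v\<in>S. count_list xs v = f v)"
  using assms
proof induction
  case (insert v S)
  then obtain xs where xs: "set xs \<subseteq> S" "\<forall>v\<in>S. count_list xs v = f v" by blast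
  have rep: "count_list (replicate n v) u = (if u = v then n else 0)" for n u
    by (induction n) auto
  have "count_list xs v = 0" using xs insert by (auto simp: count_list_0_iff)
  then show ?case using xs insert
    by (intro exI[of _ "replicate (f v) v @ xs"]) (auto simp: rep)
qed simp

lemma count_list_distinct: "distinct xs \<Longrightarrow> count_list xs v \<le> 1"
  by (induction xs) (auto simp: count_list_0_iff)

text \<open>The offset \<epsilon> makes each nearest free server unique, so the bound covers every
  rule for breaking ties.\<close>

lemma greedy_lower_bound:
  assumes S: "S = s ` {1..k}" and c: "\<And>v. v \<in> S \<Longrightarrow> 1 \<le> c v" and G: "greedy S c G"
    and comp: "competitive S c G \<beta>" and k: "2 \<le> k" and \<epsilon>: "0 < \<epsilon>" "\<epsilon> < 1" and \<beta>: "1 \<le> \<beta>"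
  shows "2 ^ k - 1 - real (k - 1) * \<epsilon> \<le> \<beta> * (1 + real (k - 1) * \<epsilon>)"
proof -
  define t where "t i = 2 ^ (i - 1) + \<epsilon>" for i :: nat
  have fin: "finite S" using S by simp
  have card: "card S = k" using S card_servers[of 1 k] by simp
  have s_pow: "s (Suc i) = 2 ^ i" if "1 \<le> i" "Suc i \<le> k" for i
    using s_power[of "Suc i"] that by simp
  obtain xs where xs: "set xs \<subseteq> S" "\<forall>v\<in>S. count_list xs v = c v - 1"
    using exists_list_count[OF fin, of "\<lambda>v. c v - 1"] by blast
  define M0 where "M0 = map (\<lambda>r. (r, r)) xs"
  have snd_M0: "map snd M0 = xs" "map fst M0 = xs" by (simp_all add: M0_def comp_def)
  have load_M0: "load M0 v = c v - 1" if "v \<in> S" for v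
    using xs that by (simp add: load_def snd_M0)
  have cost_M0: "match_cost M0 = 0" by (simp add: M0_def match_cost_def comp_def)
  have fill: "serve G [] xs = M0"
    using serve_greedy_fill[OF G xs(1), of "[]"] xs(2) by (simp add: load_def M0_def)
  \<comment> \<open>After \<open>j\<close> of these requests exactly the servers 2 to
    \<open>Suc j\<close> are full. The next one is then nearer to the following server than to 0, by
    \<open>2 * \<epsilon>\<close>.\<close>
  have chain: "serve G M0 (map t [1..<Suc j]) = M0 @ map (\<lambda>i. (t i, s (Suc i))) [1..<Suc j] \<and>
      (\<forall>i\<in>{1..k}. load (M0 @ map (\<lambda>i. (t i, s (Suc i))) [1..<Suc j]) (s i) =
        c (s i) - 1 + (if 2 \<le> i \<and> i \<le> Suc j then 1 else 0))" if "j < k" for j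
    using that
  proof (induction j)
    case 0
    then show ?case using load_M0 S by auto
  next
    case (Suc j)
    define M where "M = M0 @ map (\<lambda>i. (t i, s (Suc i))) [1..<Suc j]"
    have IH: "serve G M0 (map t [1..<Suc j]) = M"
      "\<And>i. i \<in> {1..k} \<Longrightarrow> load M (s i) = c (s i) - 1 + (if 2 \<le> i \<and> i \<le> Suc j then 1 else 0)"
      using Suc unfolding M_def by auto
    have free: "s i \<in> free S c M \<longleftrightarrow> i = 1 \<or> Suc (Suc j) \<le> i" if "i \<in> {1..k}" for i
      using IH(2)[OF that] c[of "s i"] that S by (auto simp: free_def)
    have s2: "s (Suc (Suc j)) = 2 ^ Suc j" using s_pow[of "Suc j"] Suc.prems by simp
    have G_eq: "G M (t (Suc j)) = s (Suc (Suc j))"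
    proof (rule greedy_nearest[OF G])
      show "s (Suc (Suc j)) \<in> free S c M" using free[of "Suc (Suc j)"] Suc.prems by simp
      fix u assume u: "u \<in> free S c M" "u \<noteq> s (Suc (Suc j))"
      then obtain i where i: "i \<in> {1..k}" "u = s i" using S by (auto simp: free_def)
      have pow: "\<epsilon> < 2 ^ j" using \<epsilon>(2) one_le_power[of "2::real" j] by linarith
      from free[OF i(1)] u i(2) consider "i = 1" | "Suc (Suc j) < i"
        by (metis le_neq_implies_less)
      then show "\<bar>t (Suc j) - s (Suc (Suc j))\<bar> < \<bar>t (Suc j) - u\<bar>"
      proof cases
        case 1
        then show ?thesis using i s_1 s2 pow \<epsilon> by (simp add: t_def)
      next
        case 2
        then have "2 ^ Suc j < s i" using s_less[of "Suc (Suc j)" i] i s2 by simp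
        then show ?thesis using i s2 pow \<epsilon> by (simp add: t_def)
      qed
    qed
    have "serve G M0 (map t [1..<Suc (Suc j)]) = M @ [(t (Suc j), s (Suc (Suc j)))]"
      using IH(1) G_eq by (simp add: serve_append)
    moreover have "M @ [(t (Suc j), s (Suc (Suc j)))] = M0 @ map (\<lambda>i. (t i, s (Suc i))) [1..<Suc (Suc j)]"
      by (simp add: M_def)
    moreover have "load (M @ [(t (Suc j), s (Suc (Suc j)))]) (s i) =
        c (s i) - 1 + (if 2 \<le> i \<and> i \<le> Suc (Suc j) then 1 else 0)" if "i \<in> {1..k}" for i
    proof -
      have "s (Suc (Suc j)) = s i \<longleftrightarrow> Suc (Suc j) = i"
        using inj_onD[OF inj_s, of "Suc (Suc j)" i] that Suc.prems by auto
      then show ?thesis using IH(2)[OF that] by (auto simp: load_append)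
    qed
    ultimately show ?case by simp
  qed
  define M where "M = M0 @ map (\<lambda>i. (t i, s (Suc i))) [1..<k]"
  have M: "serve G M0 (map t [1..<k]) = M"
    "\<And>i. i \<in> {1..k} \<Longrightarrow> load M (s i) = c (s i) - 1 + (if 2 \<le> i \<and> i \<le> k then 1 else 0)"
    using chain[of "k - 1"] k unfolding M_def by auto
  have "free S c M = {s 1}"
  proof -
    have "s i \<in> free S c M \<longleftrightarrow> i = 1" if "i \<in> {1..k}" for i
      using M(2)[OF that] c[of "s i"] that S by (auto simp: free_def)
    then show ?thesis using S k by (auto simp: free_def)
  qed
  then have last: "G M (s k) = s 1" by (intro greedy_nearest[OF G]) auto
  define \<sigma> where "\<sigma> = xs @ map t [1..<k] @ [s k]"
  have "serve G [] \<sigma> = M @ [(s k, s 1)]"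
    by (simp only: \<sigma>_def serve_append fill M(1) last serve.simps)
  moreover have "match_cost (map (\<lambda>i. (t i, s (Suc i))) [1..<k]) = 2 ^ (k - 1) - 1 - real (k - 1) * \<epsilon>"
  proof -
    have "match_cost (map (\<lambda>i. (t i, s (Suc i))) [1..<k]) = (\<Sum>i\<leftarrow>[1..<k]. \<bar>t i - s (Suc i)\<bar>)"
      by (simp add: match_cost_def comp_def)
    also have "\<dots> = (\<Sum>i=1..<k. \<bar>t i - s (Suc i)\<bar>)"
      by (simp add: sum_list_distinct_conv_sum_set)
    also have "\<dots> = (\<Sum>i=1..<k. 2 ^ i - 2 ^ (i - 1) - \<epsilon>)"
    proof (rule sum.cong)
      fix i assume i: "i \<in> {1..<k}"
      then obtain n where n: "i = Suc n" by (cases i) auto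
      have "\<epsilon> < 2 ^ n" using \<epsilon>(2) one_le_power[of "2::real" n] by linarith
      then show "\<bar>t i - s (Suc i)\<bar> = 2 ^ i - 2 ^ (i - 1) - \<epsilon>"
        using s_pow[of i] i \<epsilon> n by (simp add: t_def)
    qed simp
    also have "\<dots> = (\<Sum>i=1..<k. 2 ^ (Suc i - 1) - 2 ^ (i - 1)) - real (k - 1) * \<epsilon>"
      by (simp add: sum_subtractf)
    also have "(\<Sum>i=1..<k. 2 ^ (Suc i - 1) - 2 ^ (i - 1)) = (2::real) ^ (k - 1) - 1"
      using sum_Suc_diff'[of 1 k "\<lambda>i. (2::real) ^ (i - 1)"] k by simp
    finally show ?thesis .
  qed
  moreover have sk: "s k = 2 ^ (k - 1)" using s_power[of k] k by simp
  moreover have "(2::real) ^ k = 2 ^ (k - 1) + 2 ^ (k - 1)" using k by (cases k) auto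
  ultimately have alg: "alg_cost G \<sigma> = 2 ^ k - 1 - real (k - 1) * \<epsilon>"
    using s_1 by (simp add: alg_cost_def M_def match_cost_append cost_M0 match_cost_Cons match_cost_Nil)
  define N where "N = M0 @ map (\<lambda>i. (t i, s i)) [1..<k] @ [(s k, s k)]"
  have "map snd N = xs @ map s [1..<Suc k]" using k by (simp add: N_def snd_M0)
  then have load_N: "load N v = load M0 v + count_list (map s [1..<Suc k]) v" for v
    by (simp only: load_def count_list_append snd_M0)
  have "distinct (map s [1..<Suc k])"
    using inj_s by (simp add: distinct_map atLeastLessThanSuc_atLeastAtMost del: upt_Suc)
  then have "load N v \<le> c v" if "v \<in> S" for v
    using load_N[of v] load_M0[OF that] c[OF that] count_list_distinct[of "map s [1..<Suc k]" v] by linarith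
  moreover have "map fst N = \<sigma>" by (simp add: N_def \<sigma>_def snd_M0)
  moreover have "snd ` set N \<subseteq> S"
    using xs(1) k by (auto simp: N_def M0_def S)
  ultimately have "N \<in> matchings S c \<sigma>" by (simp add: matchings_def)
  then have "Opt S c \<sigma> \<le> match_cost N" by (rule Opt_le[OF fin])
  also have "match_cost N = (\<Sum>i=1..<k. \<bar>t i - s i\<bar>)"
    by (simp add: N_def match_cost_append match_cost_Cons match_cost_Nil cost_M0)
       (simp add: match_cost_def comp_def sum_list_distinct_conv_sum_set)
  \<comment> \<open>Only \<open>t 1\<close> is far from its server, because \<open>s 1\<close> is 0
    instead of \<open>2 ^ 0\<close>.\<close>
  also have "\<dots> = (\<Sum>i=1..<k. \<epsilon> + (if i = 1 then 1 else 0))"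
    using s_1 s_power \<epsilon> by (intro sum.cong) (auto simp: t_def)
  also have "\<dots> = 1 + real (k - 1) * \<epsilon>" using k by (simp add: sum.distrib)
  finally have opt: "Opt S c \<sigma> \<le> 1 + real (k - 1) * \<epsilon>" .
  have "length \<sigma> = (\<Sum>v\<in>S. c v)"
  proof -
    have "length xs = (\<Sum>v\<in>S. c v - 1)"
      using sum_count_set[OF xs(1) fin] xs(2) by simp
    moreover have "(\<Sum>v\<in>S. c v) = (\<Sum>v\<in>S. (c v - 1) + 1)"
      using le_add_diff_inverse2[OF c] by simp
    ultimately show ?thesis using k card by (simp only: \<sigma>_def sum.distrib) simp
  qed
  then have "alg_cost G \<sigma> \<le> \<beta> * Opt S c \<sigma>" using comp by (simp add: competitive_def)
  also have "\<dots> \<le> \<beta> * (1 + real (k - 1) * \<epsilon>)" using opt \<beta> by (intro mult_left_mono) auto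
  finally show ?thesis using alg by simp
qed

theorem greedy_competitive_ratio:
  assumes S: "S = s ` {1..k}" and c: "\<And>v. v \<in> S \<Longrightarrow> 1 \<le> c v" and G: "greedy S c G"
  shows "ereal (2 ^ k - 1) \<le> competitive_ratio S c G"
  unfolding competitive_ratio_def
proof (rule INF_greatest, clarsimp)
  fix \<beta> :: real assume \<beta>: "1 \<le> \<beta>" "competitive S c G \<beta>"
  show "2 ^ k - 1 \<le> \<beta>"
  proof (cases "k = 1")
    case True
    then show ?thesis using \<beta> by simp
  next
    case False
    then have k: "2 \<le> k" using k_pos by simp
    show ?thesis
    proof (rule field_le_epsilon)
      fix e :: real assume e: "0 < e"
      \<comment> \<open>Collecting the terms in \<epsilon>, the bound reads
        \<open>2 ^ k - 1 \<le> \<beta> + K * \<epsilon>\<close>.\<close>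
      define K where "K = real (k - 1) * (1 + \<beta>)"
      have K: "0 < K" using k \<beta> by (simp add: K_def)
      define \<epsilon> where "\<epsilon> = min (1 / 2) (e / K)"
      have "0 < \<epsilon>" "\<epsilon> < 1" using e K by (auto simp: \<epsilon>_def)
      then have "2 ^ k - 1 - real (k - 1) * \<epsilon> \<le> \<beta> * (1 + real (k - 1) * \<epsilon>)"
        by (intro greedy_lower_bound[OF S c G \<beta>(2) k _ _ \<beta>(1)])
      then have "2 ^ k - 1 \<le> \<beta> + K * \<epsilon>" by (simp add: K_def algebra_simps)
      moreover have "K * \<epsilon> \<le> K * (e / K)" using K by (intro mult_left_mono) (auto simp: \<epsilon>_def)
      ultimately show "2 ^ k - 1 \<le> \<beta> + e" using K by simp
    qed
  qed
qed

end

theorem theorem3: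
  fixes k :: nat and s :: "nat \<Rightarrow> real" and S :: "real set" and c :: "real \<Rightarrow> nat"
  assumes "k \<ge> 1"
    and "s 1 = 0"
    and "\<And>i. i \<in> {2..k} \<Longrightarrow> s i = 2 ^ (i - 1)"
    and "S = s ` {1..k}"
    and "\<And>x. x \<in> S \<Longrightarrow> c x \<ge> 1"
  shows "(\<forall>\<tau>. gap_choice S \<tau> \<longrightarrow> competitive S c (ptcp_alg \<tau> S c) 5) \<and>
         (\<forall>G. greedy S c G \<longrightarrow> competitive_ratio S c G \<ge> ereal (2 ^ k - 1))"
proof -
  interpret doubling_servers k s
    using assms(1-3) by unfold_locales
  show ?thesis
    using ptcp_competitive[OF assms(4)] greedy_competitive_ratio[where c = c, OF assms(4,5)] by blast
qed

end
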